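(* The category of locally finite MV-algebras is not equivalent (as a category) to any finitely-sorted quasi-variety of finitary algebras.
   Context: MV-algebras: an MV-algebra is an algebra $\langle A,\oplus,\neg,0\rangle$ such that $\langle A,\oplus,0\rangle$ is a monoid, $\neg\neg x=x$, $\neg 0\oplus x=\neg 0$, and $\neg(\neg x\oplus y)\oplus y=\neg(\neg y\oplus x)\oplus x$. An MV-algebra is locally finite if each of its finitely generated subalgebras is finite. The category of locally finite MV-algebras has all locally finite MV-algebras as objects and all MV-homomorphisms between them as arrows. Quasi-varieties: given a set $S$ of sorts, an $S$-sorted signature is a (possibly large) class $\Sigma$ of operation symbols, each with an arity consisting of a family $(s_i)_{i<\kappa}$ of input sorts ($\kappa$ a cardinal) and an output sort $s\in S$. It is finitary if $\kappa$ is finite for every symbol. A $\Sigma$-algebra is an $S$-indexed family of sets with corresponding operations; homomorphisms are $S$-indexed families of maps commuting with the operations. A quasi-equation is a universally quantified formula $\left(\bigwedge_{i\in I}(u_i=v_i)\right)\Rightarrow(u_0=v_0)$, where $I$ is a (possibly infinite) set and, for each $i\in I\cup\{0\}$, $u_i,v_i$ are terms of the same sort over a given ($S$-sorted) set of variables. An $S$-sorted quasi-variety of $\Sigma$-algebras is a class of $\Sigma$-algebras that can be presented by a class of quasi-equations and that has free algebras (over every $S$-sorted set); it is regarded as a category with all homomorphisms. It is a quasi-variety of finitary algebras if $\Sigma$ is finitary, and it is finitely-sorted if $S$ is finite. *)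

theory Defs
  imports Complex_Main "HOL.Hull" "HOL-Library.FuncSet" "HOL-Library.Countable_Set"
begin

section \<open>Sets and classes\<close>

text \<open>
  HOL has no type of all sets, so the universe of sets is a parameter: a type \<open>'v\<close> of
  elements, with a predicate \<open>small\<close> selecting those collections of elements that are sets, as
  opposed to proper classes. Only closure properties that sets have in every set theory with
  replacement and infinity are required; they give all finite sets and, up to a bijection, finite
  products. The power set axiom is not imposed: universes of ZFC are included, and so is
  for example ``small = countable'', so that the notion is not void in HOL.
\<close>

definition set_universe :: "('v set \<Rightarrow> bool) \<Rightarrow> bool" where
  "set_universe small \<longleftrightarrow>
     (\<exists>A. small A \<and> infinite A) \<and>
     (\<forall>A B. small A \<and> B \<subseteq> A \<longrightarrow> small B) \<and>
     (\<forall>A f. small A \<longrightarrow> small (f ` A)) \<and>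
     (\<forall>A F. small A \<and> (\<forall>a\<in>A. small (F a)) \<longrightarrow> small (\<Union>a\<in>A. F a))"

lemma set_universe_zf:
  fixes elts :: "'v \<Rightarrow> 'v set"
  assumes infinity: "\<exists>x. infinite (elts x)"
    and separation: "\<And>x P. \<exists>y. elts y = {z \<in> elts x. P z}"
    and replacement: "\<And>x f. \<exists>y. elts y = f ` elts x"
    and union: "\<And>x. \<exists>y. elts y = (\<Union>z\<in>elts x. elts z)"
  shows "set_universe (\<lambda>A. \<exists>x. elts x = A)"
proof -
  have sub: "\<exists>y. elts y = B" if "B \<subseteq> elts x" for x B
    using separation[of x "\<lambda>z. z \<in> B"] that by (simp add: Collect_conj_eq Int_absorb1)
  have Un: "\<exists>y. elts y = (\<Union>a\<in>elts x. F a)" if F: "\<forall>a\<in>elts x. \<exists>z. elts z = F a" for x F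
  proof -
    from F obtain G where G: "\<forall>a\<in>elts x. elts (G a) = F a" by metis
    obtain z where z: "elts z = G ` elts x" using replacement by blast
    obtain y where "elts y = (\<Union>w\<in>elts z. elts w)" using union by blast
    then have "elts y = (\<Union>a\<in>elts x. F a)" using z G by simp
    then show ?thesis by blast
  qed
  show ?thesis
    unfolding set_universe_def
  proof (intro conjI allI impI)
    show "\<exists>A. (\<exists>x. elts x = A) \<and> infinite A" using infinity by blast
    show "\<exists>x. elts x = B" if "(\<exists>x. elts x = A) \<and> B \<subseteq> A" for A B using that sub by blast
    show "\<exists>x. elts x = f ` A" if "\<exists>x. elts x = A" for A f using that replacement by blast
    show "\<exists>x. elts x = (\<Union>a\<in>A. F a)"
      if "(\<exists>x. elts x = A) \<and> (\<forall>a\<in>A. \<exists>x. elts x = F a)" for A F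
      using that Un by blast
  qed
qed

lemma set_universe_countable: "set_universe (countable :: real set \<Rightarrow> bool)"
  unfolding set_universe_def
proof (intro conjI allI impI)
  show "\<exists>A::real set. countable A \<and> infinite A"
    by (rule exI[of _ "range real"]) (simp add: finite_image_iff inj_on_def)
qed (auto intro: countable_subset)

section \<open>Categories and equivalence of categories\<close>

text \<open>Arrows need not determine their source and target, hence the object arguments of \<open>comp\<close>:
  \<open>comp C X Y Z g f\<close> is the composite of \<open>f : X \<rightarrow> Y\<close> and \<open>g : Y \<rightarrow> Z\<close>.\<close>

record ('x, 'a) category =
  obj :: "'x set"
  hom :: "'x \<Rightarrow> 'x \<Rightarrow> 'a set"
  idt :: "'x \<Rightarrow> 'a"
  comp :: "'x \<Rightarrow> 'x \<Rightarrow> 'x \<Rightarrow> 'a \<Rightarrow> 'a \<Rightarrow> 'a"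

definition is_category :: "('x, 'a) category \<Rightarrow> bool" where
  "is_category C \<longleftrightarrow>
     (\<forall>X\<in>obj C. idt C X \<in> hom C X X) \<and>
     (\<forall>X\<in>obj C. \<forall>Y\<in>obj C. \<forall>Z\<in>obj C. \<forall>f\<in>hom C X Y. \<forall>g\<in>hom C Y Z.
        comp C X Y Z g f \<in> hom C X Z) \<and>
     (\<forall>X\<in>obj C. \<forall>Y\<in>obj C. \<forall>f\<in>hom C X Y.
        comp C X X Y f (idt C X) = f \<and> comp C X Y Y (idt C Y) f = f) \<and>
     (\<forall>W\<in>obj C. \<forall>X\<in>obj C. \<forall>Y\<in>obj C. \<forall>Z\<in>obj C.
        \<forall>f\<in>hom C W X. \<forall>g\<in>hom C X Y. \<forall>h\<in>hom C Y Z.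
        comp C W Y Z h (comp C W X Y g f) = comp C W X Z (comp C X Y Z h g) f)"

definition iso_arrow :: "('x, 'a) category \<Rightarrow> 'x \<Rightarrow> 'x \<Rightarrow> 'a \<Rightarrow> bool" where
  "iso_arrow C X Y f \<longleftrightarrow> f \<in> hom C X Y \<and>
     (\<exists>g\<in>hom C Y X. comp C X Y X g f = idt C X \<and> comp C Y X Y f g = idt C Y)"

record ('x, 'a, 'y, 'b) cat_functor =
  omap :: "'x \<Rightarrow> 'y"
  amap :: "'x \<Rightarrow> 'x \<Rightarrow> 'a \<Rightarrow> 'b"

definition is_functor ::
    "('x, 'a) category \<Rightarrow> ('y, 'b) category \<Rightarrow> ('x, 'a, 'y, 'b) cat_functor \<Rightarrow> bool" where
  "is_functor C D F \<longleftrightarrow>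
     (\<forall>X\<in>obj C. omap F X \<in> obj D) \<and>
     (\<forall>X\<in>obj C. \<forall>Y\<in>obj C. \<forall>f\<in>hom C X Y. amap F X Y f \<in> hom D (omap F X) (omap F Y)) \<and>
     (\<forall>X\<in>obj C. amap F X X (idt C X) = idt D (omap F X)) \<and>
     (\<forall>X\<in>obj C. \<forall>Y\<in>obj C. \<forall>Z\<in>obj C. \<forall>f\<in>hom C X Y. \<forall>g\<in>hom C Y Z.
        amap F X Z (comp C X Y Z g f) =
          comp D (omap F X) (omap F Y) (omap F Z) (amap F Y Z g) (amap F X Y f))"

definition id_functor :: "('x, 'a, 'x, 'a) cat_functor" where
  "id_functor = \<lparr>omap = (\<lambda>X. X), amap = (\<lambda>X Y f. f)\<rparr>"

definition comp_functor ::
    "('y, 'b, 'z, 'c) cat_functor \<Rightarrow> ('x, 'a, 'y, 'b) cat_functor \<Rightarrow> ('x, 'a, 'z, 'c) cat_functor" where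
  "comp_functor G F =
     \<lparr>omap = (\<lambda>X. omap G (omap F X)),
      amap = (\<lambda>X Y f. amap G (omap F X) (omap F Y) (amap F X Y f))\<rparr>"

definition natural_iso ::
    "('x, 'a) category \<Rightarrow> ('y, 'b) category \<Rightarrow>
     ('x, 'a, 'y, 'b) cat_functor \<Rightarrow> ('x, 'a, 'y, 'b) cat_functor \<Rightarrow> ('x \<Rightarrow> 'b) \<Rightarrow> bool" where
  "natural_iso C D F G \<eta> \<longleftrightarrow>
     (\<forall>X\<in>obj C. iso_arrow D (omap F X) (omap G X) (\<eta> X)) \<and>
     (\<forall>X\<in>obj C. \<forall>Y\<in>obj C. \<forall>f\<in>hom C X Y.
        comp D (omap F X) (omap F Y) (omap G Y) (\<eta> Y) (amap F X Y f) =
        comp D (omap F X) (omap G X) (omap G Y) (amap G X Y f) (\<eta> X))"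

definition equivalent_categories :: "('x, 'a) category \<Rightarrow> ('y, 'b) category \<Rightarrow> bool" where
  "equivalent_categories C D \<longleftrightarrow>
     (\<exists>F G \<eta> \<epsilon>. is_functor C D F \<and> is_functor D C G \<and>
        natural_iso C C id_functor (comp_functor G F) \<eta> \<and>
        natural_iso D D (comp_functor F G) id_functor \<epsilon>)"

section \<open>Locally finite MV-algebras\<close>

record 'v mv_alg =
  mv_carrier :: "'v set"
  mv_plus :: "'v \<Rightarrow> 'v \<Rightarrow> 'v"
  mv_neg :: "'v \<Rightarrow> 'v"
  mv_zero :: "'v"

definition mv_algebra :: "'v mv_alg \<Rightarrow> bool" where
  "mv_algebra M \<longleftrightarrow>
     (let A = mv_carrier M; p = mv_plus M; n = mv_neg M; z = mv_zero M in
      z \<in> A \<and> (\<forall>x\<in>A. n x \<in> A) \<and> (\<forall>x\<in>A. \<forall>y\<in>A. p x y \<in> A) \<and>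
      (\<forall>x\<in>A. \<forall>y\<in>A. \<forall>w\<in>A. p (p x y) w = p x (p y w)) \<and>
      (\<forall>x\<in>A. p z x = x \<and> p x z = x) \<and>
      (\<forall>x\<in>A. n (n x) = x) \<and>
      (\<forall>x\<in>A. p (n z) x = n z) \<and>
      (\<forall>x\<in>A. \<forall>y\<in>A. p (n (p (n x) y)) y = p (n (p (n y) x)) x))"

definition mv_subalgebra :: "'v mv_alg \<Rightarrow> 'v set \<Rightarrow> bool" where
  "mv_subalgebra M B \<longleftrightarrow>
     B \<subseteq> mv_carrier M \<and> mv_zero M \<in> B \<and>
     (\<forall>x\<in>B. mv_neg M x \<in> B) \<and> (\<forall>x\<in>B. \<forall>y\<in>B. mv_plus M x y \<in> B)"

text \<open>\<open>mv_subalgebra M hull X\<close> is the intersection of all subalgebras of \<open>M\<close> containing \<open>X\<close>.\<close>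

definition locally_finite_mv :: "'v mv_alg \<Rightarrow> bool" where
  "locally_finite_mv M \<longleftrightarrow>
     mv_algebra M \<and> (\<forall>X. finite X \<and> X \<subseteq> mv_carrier M \<longrightarrow> finite (mv_subalgebra M hull X))"

text \<open>Homomorphisms are functions on the carrier, represented as usual by functions that are
  undefined elsewhere, so that equality in the logic is equality of homomorphisms. (Two objects
  whose operations differ only outside the carrier are isomorphic.)\<close>

definition mv_hom :: "'v mv_alg \<Rightarrow> 'v mv_alg \<Rightarrow> ('v \<Rightarrow> 'v) set" where
  "mv_hom M N =
     {h \<in> mv_carrier M \<rightarrow>\<^sub>E mv_carrier N.
        h (mv_zero M) = mv_zero N \<and>
        (\<forall>x\<in>mv_carrier M. h (mv_neg M x) = mv_neg N (h x)) \<and>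
        (\<forall>x\<in>mv_carrier M. \<forall>y\<in>mv_carrier M. h (mv_plus M x y) = mv_plus N (h x) (h y))}"

definition lf_mv_category :: "('v set \<Rightarrow> bool) \<Rightarrow> ('v mv_alg, 'v \<Rightarrow> 'v) category" where
  "lf_mv_category small =
     \<lparr>obj = {M. small (mv_carrier M) \<and> locally_finite_mv M},
      hom = mv_hom,
      idt = (\<lambda>M. restrict id (mv_carrier M)),
      comp = (\<lambda>L M N g f. compose (mv_carrier L) g f)\<rparr>"

section \<open>Many-sorted finitary algebras and quasi-varieties\<close>

text \<open>Finitary signatures only: the input sorts of an operation symbol form a list. The symbols may
  form an arbitrarily large class, since their type is unrelated to the universe of sets.\<close>

record ('o, 's) signature =
  ops :: "'o set"
  insorts :: "'o \<Rightarrow> 's list"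
  outsort :: "'o \<Rightarrow> 's"

definition finitary_signature :: "'s set \<Rightarrow> ('o, 's) signature \<Rightarrow> bool" where
  "finitary_signature S \<Sigma> \<longleftrightarrow> (\<forall>f\<in>ops \<Sigma>. set (insorts \<Sigma> f) \<subseteq> S \<and> outsort \<Sigma> f \<in> S)"

record ('o, 's, 'v) algebra =
  carrier :: "'s \<Rightarrow> 'v set"
  interp :: "'o \<Rightarrow> 'v list \<Rightarrow> 'v"

text \<open>\<open>args \<Sigma> A f\<close> is the product of the carriers of the input sorts of \<open>f\<close>.\<close>

definition args :: "('o, 's) signature \<Rightarrow> ('o, 's, 'v) algebra \<Rightarrow> 'o \<Rightarrow> 'v list set" where
  "args \<Sigma> A f = {xs. list_all2 (\<lambda>x s. x \<in> carrier A s) xs (insorts \<Sigma> f)}"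

definition sig_algebra ::
    "('v set \<Rightarrow> bool) \<Rightarrow> 's set \<Rightarrow> ('o, 's) signature \<Rightarrow> ('o, 's, 'v) algebra \<Rightarrow> bool" where
  "sig_algebra small S \<Sigma> A \<longleftrightarrow>
     (\<forall>s\<in>S. small (carrier A s)) \<and>
     (\<forall>f\<in>ops \<Sigma>. \<forall>xs\<in>args \<Sigma> A f. interp A f xs \<in> carrier A (outsort \<Sigma> f))"

definition sig_hom ::
    "'s set \<Rightarrow> ('o, 's) signature \<Rightarrow> ('o, 's, 'v) algebra \<Rightarrow> ('o, 's, 'v) algebra \<Rightarrow>
     ('s \<Rightarrow> 'v \<Rightarrow> 'v) set" where
  "sig_hom S \<Sigma> A B =
     {h \<in> (\<Pi>\<^sub>E s\<in>S. carrier A s \<rightarrow>\<^sub>E carrier B s).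
        \<forall>f\<in>ops \<Sigma>. \<forall>xs\<in>args \<Sigma> A f.
          h (outsort \<Sigma> f) (interp A f xs) = interp B f (map2 h (insorts \<Sigma> f) xs)}"

definition algebra_category ::
    "'s set \<Rightarrow> ('o, 's) signature \<Rightarrow> ('o, 's, 'v) algebra set \<Rightarrow>
     (('o, 's, 'v) algebra, 's \<Rightarrow> 'v \<Rightarrow> 'v) category" where
  "algebra_category S \<Sigma> K =
     \<lparr>obj = K,
      hom = sig_hom S \<Sigma>,
      idt = (\<lambda>A. \<lambda>s\<in>S. restrict id (carrier A s)),
      comp = (\<lambda>A B C g f. \<lambda>s\<in>S. compose (carrier A s) (g s) (f s))\<rparr>"

datatype ('o, 's, 'v) tm = Var 's 'v | App 'o "('o, 's, 'v) tm list"

inductive has_sort ::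
    "'s set \<Rightarrow> ('o, 's) signature \<Rightarrow> ('s \<Rightarrow> 'v set) \<Rightarrow> ('o, 's, 'v) tm \<Rightarrow> 's \<Rightarrow> bool"
  for S \<Sigma> X where
  "s \<in> S \<Longrightarrow> x \<in> X s \<Longrightarrow> has_sort S \<Sigma> X (Var s x) s"
| "f \<in> ops \<Sigma> \<Longrightarrow> list_all2 (has_sort S \<Sigma> X) ts (insorts \<Sigma> f) \<Longrightarrow>
     has_sort S \<Sigma> X (App f ts) (outsort \<Sigma> f)"

primrec tm_val ::
    "('o, 's, 'v) algebra \<Rightarrow> ('s \<Rightarrow> 'v \<Rightarrow> 'v) \<Rightarrow> ('o, 's, 'v) tm \<Rightarrow> 'v" where
  "tm_val A \<rho> (Var s x) = \<rho> s x"
| "tm_val A \<rho> (App f ts) = interp A f (map (tm_val A \<rho>) ts)"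

text \<open>The premises are a family of equations, indexed by a possibly infinite set.\<close>

record ('o, 's, 'v) quasi_eq =
  vars :: "'s \<Rightarrow> 'v set"
  index :: "'v set"
  premise :: "'v \<Rightarrow> ('o, 's, 'v) tm \<times> ('o, 's, 'v) tm"
  conclusion :: "('o, 's, 'v) tm \<times> ('o, 's, 'v) tm"

definition wf_quasi_eq ::
    "('v set \<Rightarrow> bool) \<Rightarrow> 's set \<Rightarrow> ('o, 's) signature \<Rightarrow> ('o, 's, 'v) quasi_eq \<Rightarrow> bool" where
  "wf_quasi_eq small S \<Sigma> q \<longleftrightarrow>
     (\<forall>s\<in>S. small (vars q s)) \<and> small (index q) \<and>
     (\<forall>(u, v)\<in>insert (conclusion q) (premise q ` index q).
        \<exists>s. has_sort S \<Sigma> (vars q) u s \<and> has_sort S \<Sigma> (vars q) v s)"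

definition satisfies ::
    "'s set \<Rightarrow> ('o, 's, 'v) algebra \<Rightarrow> ('o, 's, 'v) quasi_eq \<Rightarrow> bool" where
  "satisfies S A q \<longleftrightarrow>
     (\<forall>\<rho>. (\<forall>s\<in>S. \<rho> s \<in> vars q s \<rightarrow> carrier A s) \<longrightarrow>
        (\<forall>i\<in>index q. tm_val A \<rho> (fst (premise q i)) = tm_val A \<rho> (snd (premise q i))) \<longrightarrow>
        tm_val A \<rho> (fst (conclusion q)) = tm_val A \<rho> (snd (conclusion q)))"

definition free_algebra ::
    "'s set \<Rightarrow> ('o, 's) signature \<Rightarrow> ('o, 's, 'v) algebra set \<Rightarrow> ('s \<Rightarrow> 'v set) \<Rightarrow>
     ('o, 's, 'v) algebra \<Rightarrow> ('s \<Rightarrow> 'v \<Rightarrow> 'v) \<Rightarrow> bool" where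
  "free_algebra S \<Sigma> K X A \<eta> \<longleftrightarrow>
     A \<in> K \<and> (\<forall>s\<in>S. \<eta> s \<in> X s \<rightarrow> carrier A s) \<and>
     (\<forall>B\<in>K. \<forall>\<phi>. (\<forall>s\<in>S. \<phi> s \<in> X s \<rightarrow> carrier B s) \<longrightarrow>
        (\<exists>!h. h \<in> sig_hom S \<Sigma> A B \<and> (\<forall>s\<in>S. \<forall>x\<in>X s. h s (\<eta> s x) = \<phi> s x)))"

text \<open>An \<open>S\<close>-sorted quasi-variety \<open>K\<close> of finitary algebras with signature \<open>\<Sigma>\<close>.\<close>

definition finitary_quasi_variety ::
    "('v set \<Rightarrow> bool) \<Rightarrow> 's set \<Rightarrow> ('o, 's) signature \<Rightarrow> ('o, 's, 'v) algebra set \<Rightarrow> bool" where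
  "finitary_quasi_variety small S \<Sigma> K \<longleftrightarrow>
     finitary_signature S \<Sigma> \<and>
     (\<exists>E. (\<forall>q\<in>E. wf_quasi_eq small S \<Sigma> q) \<and>
          K = {A. sig_algebra small S \<Sigma> A \<and> (\<forall>q\<in>E. satisfies S A q)}) \<and>
     (\<forall>X. (\<forall>s\<in>S. small (X s)) \<longrightarrow> (\<exists>A \<eta>. free_algebra S \<Sigma> K X A \<eta>))"

section \<open>The two categories are categories\<close>

lemma compose_units:
  assumes "f \<in> A \<rightarrow>\<^sub>E B"
  shows "compose A f (restrict id A) = f" "compose A (restrict id B) f = f"
  using assms by (auto simp: compose_def PiE_def extensional_def intro!: ext)

lemma compose_assoc_PiE:
  assumes "f \<in> A \<rightarrow>\<^sub>E B"
  shows "compose A h (compose A g f) = compose A (compose B h g) f"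
  using assms by (auto simp: compose_def PiE_def intro!: ext)

lemma is_category_lf_mv: "is_category (lf_mv_category small)"
proof -
  have mapsto: "f \<in> mv_carrier M \<rightarrow>\<^sub>E mv_carrier N" if "f \<in> mv_hom M N" for M N :: "'a mv_alg" and f
    using that by (simp add: mv_hom_def)
  have "restrict id (mv_carrier M) \<in> mv_hom M M" if "locally_finite_mv M" for M :: "'a mv_alg"
    using that by (auto simp: mv_hom_def locally_finite_mv_def mv_algebra_def Let_def)
  moreover have "compose (mv_carrier L) g f \<in> mv_hom L N"
    if "locally_finite_mv L" "f \<in> mv_hom L M" "g \<in> mv_hom M N" for L M N :: "'a mv_alg" and f g
  proof -
    have f: "f x \<in> mv_carrier M" if "x \<in> mv_carrier L" for x
      using mapsto[OF \<open>f \<in> mv_hom L M\<close>] that by (rule PiE_mem)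
    have g: "g x \<in> mv_carrier N" if "x \<in> mv_carrier M" for x
      using mapsto[OF \<open>g \<in> mv_hom M N\<close>] that by (rule PiE_mem)
    show ?thesis
      using that f g
      by (simp add: mv_hom_def locally_finite_mv_def mv_algebra_def Let_def compose_def)
  qed
  ultimately show ?thesis
    unfolding is_category_def lf_mv_category_def category.simps
    using compose_units[OF mapsto] compose_assoc_PiE[OF mapsto] by (intro conjI ballI) blast+
qed

lemma args_map2:
  assumes "xs \<in> args \<Sigma> A f" "set (insorts \<Sigma> f) \<subseteq> S"
    and "\<And>s x. s \<in> S \<Longrightarrow> x \<in> carrier A s \<Longrightarrow> h s x \<in> carrier B s"
  shows "map2 h (insorts \<Sigma> f) xs \<in> args \<Sigma> B f"
  using assms by (simp add: args_def list_all2_conv_all_nth subset_iff)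

lemma map2_args_cong:
  assumes "xs \<in> args \<Sigma> A f" "set (insorts \<Sigma> f) \<subseteq> S"
    and "\<And>s x. s \<in> S \<Longrightarrow> x \<in> carrier A s \<Longrightarrow> h s x = k s x"
  shows "map2 h (insorts \<Sigma> f) xs = map2 k (insorts \<Sigma> f) xs"
  using assms by (intro nth_equalityI) (simp_all add: args_def list_all2_conv_all_nth subset_iff)

lemma map2_snd_args:
  assumes "xs \<in> args \<Sigma> A f"
  shows "map2 (\<lambda>s x. x) (insorts \<Sigma> f) xs = xs"
  using assms by (intro nth_equalityI) (simp_all add: args_def list_all2_conv_all_nth)

lemma map2_map2:
  assumes "xs \<in> args \<Sigma> A f"
  shows "map2 g (insorts \<Sigma> f) (map2 h (insorts \<Sigma> f) xs) =
         map2 (\<lambda>s x. g s (h s x)) (insorts \<Sigma> f) xs"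
  using assms by (intro nth_equalityI) (simp_all add: args_def list_all2_conv_all_nth)

lemma is_category_algebra_category:
  assumes "finitary_quasi_variety small S \<Sigma> K"
  shows "is_category (algebra_category S \<Sigma> K)"
proof -
  from assms have sig: "finitary_signature S \<Sigma>"
    and alg: "\<And>A. A \<in> K \<Longrightarrow> sig_algebra small S \<Sigma> A"
    unfolding finitary_quasi_variety_def by blast+
  have inp: "set (insorts \<Sigma> f) \<subseteq> S" and outp: "outsort \<Sigma> f \<in> S" if "f \<in> ops \<Sigma>" for f
    using sig that by (simp_all add: finitary_signature_def)
  have val: "interp A f xs \<in> carrier A (outsort \<Sigma> f)"
    if "A \<in> K" "f \<in> ops \<Sigma>" "xs \<in> args \<Sigma> A f" for A f xs
    using alg that by (simp add: sig_algebra_def)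
  have PiE: "h s \<in> carrier A s \<rightarrow>\<^sub>E carrier B s" if "h \<in> sig_hom S \<Sigma> A B" "s \<in> S" for A B h s
    using that by (simp add: sig_hom_def PiE_iff)
  have extn: "h s = undefined" if "h \<in> sig_hom S \<Sigma> A B" "s \<notin> S" for A B h s
    using that by (simp add: sig_hom_def PiE_iff extensional_def)
  have "(\<lambda>s\<in>S. restrict id (carrier A s)) \<in> sig_hom S \<Sigma> A A" if "A \<in> K" for A
  proof -
    let ?i = "\<lambda>s\<in>S. restrict id (carrier A s)"
    have "?i (outsort \<Sigma> f) (interp A f xs) = interp A f (map2 ?i (insorts \<Sigma> f) xs)"
      if f: "f \<in> ops \<Sigma>" and xs: "xs \<in> args \<Sigma> A f" for f xs
    proof -
      have "map2 ?i (insorts \<Sigma> f) xs = map2 (\<lambda>s x. x) (insorts \<Sigma> f) xs"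
        by (rule map2_args_cong[OF xs inp[OF f]]) simp
      also have "\<dots> = xs" by (rule map2_snd_args[OF xs])
      finally show ?thesis
        using val[OF \<open>A \<in> K\<close> f xs] outp[OF f] by (simp only: restrict_apply' id_apply)
    qed
    moreover have "?i \<in> (\<Pi>\<^sub>E s\<in>S. carrier A s \<rightarrow>\<^sub>E carrier A s)" by (auto simp: PiE_iff)
    ultimately show ?thesis unfolding sig_hom_def by blast
  qed
  moreover have "(\<lambda>s\<in>S. compose (carrier A s) (g s) (h s)) \<in> sig_hom S \<Sigma> A C"
    if A: "A \<in> K" and h: "h \<in> sig_hom S \<Sigma> A B" and g: "g \<in> sig_hom S \<Sigma> B C" for A B C h g
  proof -
    let ?k = "\<lambda>s\<in>S. compose (carrier A s) (g s) (h s)"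
    have hm: "h s x \<in> carrier B s" if "s \<in> S" "x \<in> carrier A s" for s x
      using PiE[OF h that(1)] that(2) by (rule PiE_mem)
    have gm: "g s x \<in> carrier C s" if "s \<in> S" "x \<in> carrier B s" for s x
      using PiE[OF g that(1)] that(2) by (rule PiE_mem)
    have "?k (outsort \<Sigma> f) (interp A f xs) = interp C f (map2 ?k (insorts \<Sigma> f) xs)"
      if f: "f \<in> ops \<Sigma>" and xs: "xs \<in> args \<Sigma> A f" for f xs
    proof -
      have "map2 ?k (insorts \<Sigma> f) xs = map2 g (insorts \<Sigma> f) (map2 h (insorts \<Sigma> f) xs)"
        unfolding map2_map2[OF xs] by (rule map2_args_cong[OF xs inp[OF f]]) (simp add: compose_eq)
      moreover have "map2 h (insorts \<Sigma> f) xs \<in> args \<Sigma> B f"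
        using args_map2[OF xs inp[OF f]] hm by blast
      ultimately show ?thesis
        using h g f xs val[OF A f xs] outp[OF f] by (simp add: sig_hom_def compose_eq)
    qed
    moreover have "?k \<in> (\<Pi>\<^sub>E s\<in>S. carrier A s \<rightarrow>\<^sub>E carrier C s)"
      using hm gm by (simp add: PiE_iff compose_def)
    ultimately show ?thesis unfolding sig_hom_def by blast
  qed
  moreover have "(\<lambda>s\<in>S. compose (carrier A s) (h s) ((\<lambda>s\<in>S. restrict id (carrier A s)) s)) = h"
      "(\<lambda>s\<in>S. compose (carrier A s) ((\<lambda>s\<in>S. restrict id (carrier B s)) s) (h s)) = h"
    if h: "h \<in> sig_hom S \<Sigma> A B" for A B h
    using compose_units[OF PiE[OF h]] extn[OF h] by (auto intro!: ext)
  moreover have "(\<lambda>s\<in>S. compose (carrier A s) (k s)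
        ((\<lambda>s\<in>S. compose (carrier A s) (g s) (h s)) s)) =
      (\<lambda>s\<in>S. compose (carrier A s) ((\<lambda>s\<in>S. compose (carrier B s) (k s) (g s)) s) (h s))"
    if h: "h \<in> sig_hom S \<Sigma> A B" for A B h g k
    using compose_assoc_PiE[OF PiE[OF h]] by (intro restrict_ext) simp
  ultimately show ?thesis
    unfolding is_category_def algebra_category_def category.simps
    by (intro conjI ballI) blast+
qed

end

theory Submission
  imports Defs "HOL-Computational_Algebra.Primes"
begin

text \<open>
  A category equivalent to an \<open>S\<close>-sorted quasi-variety of finitary algebras contains, for each sort
  \<open>s\<close>, an object \<open>P s\<close> corresponding to the free algebra on one generator of sort \<open>s\<close>. Every locally
  finite MV-algebra is the directed union of its finite subalgebras, and since the operations of the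
  quasi-variety are finitary, the generator of \<open>P s\<close> already comes from a finite subalgebra; hence
  \<open>P s\<close> is finite. If \<open>S\<close> is finite, choose a prime \<open>p\<close> exceeding the cardinality of all \<open>P s\<close>. The
  chain with \<open>p + 1\<close> elements has no proper subalgebra other than \<open>{0, 1}\<close>, so every homomorphism
  from some \<open>P s\<close> to it lands in \<open>{0, 1}\<close>. Thus the inclusion of \<open>{0, 1}\<close> corresponds to a
  homomorphism that is bijective on every sort, that is, to an isomorphism, which is absurd.
\<close>

section \<open>Equivalences of categories\<close>

definition full_faithful ::
    "('x, 'a) category \<Rightarrow> ('y, 'b) category \<Rightarrow> ('x, 'a, 'y, 'b) cat_functor \<Rightarrow> bool" where
  "full_faithful C D F \<longleftrightarrow>
     (\<forall>X\<in>obj C. \<forall>Y\<in>obj C.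
        bij_betw (amap F X Y) (hom C X Y) (hom D (omap F X) (omap F Y)))"

definition essentially_surjective ::
    "('x, 'a) category \<Rightarrow> ('y, 'b) category \<Rightarrow> ('x, 'a, 'y, 'b) cat_functor \<Rightarrow> bool" where
  "essentially_surjective C D F \<longleftrightarrow>
     (\<forall>Y\<in>obj D. \<exists>X\<in>obj C. \<exists>f. iso_arrow D (omap F X) Y f)"

lemma is_categoryD:
  assumes "is_category C"
  shows "X \<in> obj C \<Longrightarrow> idt C X \<in> hom C X X"
    and "\<lbrakk>X \<in> obj C; Y \<in> obj C; Z \<in> obj C; f \<in> hom C X Y; g \<in> hom C Y Z\<rbrakk> \<Longrightarrow>
      comp C X Y Z g f \<in> hom C X Z"
    and "\<lbrakk>X \<in> obj C; Y \<in> obj C; f \<in> hom C X Y\<rbrakk> \<Longrightarrow> comp C X X Y f (idt C X) = f"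
    and "\<lbrakk>X \<in> obj C; Y \<in> obj C; f \<in> hom C X Y\<rbrakk> \<Longrightarrow> comp C X Y Y (idt C Y) f = f"
    and "\<lbrakk>W \<in> obj C; X \<in> obj C; Y \<in> obj C; Z \<in> obj C;
        f \<in> hom C W X; g \<in> hom C X Y; h \<in> hom C Y Z\<rbrakk> \<Longrightarrow>
      comp C W Y Z h (comp C W X Y g f) = comp C W X Z (comp C X Y Z h g) f"
  using assms unfolding is_category_def by blast+

lemma is_functorD:
  assumes "is_functor C D F"
  shows "X \<in> obj C \<Longrightarrow> omap F X \<in> obj D"
    and "\<lbrakk>X \<in> obj C; Y \<in> obj C; f \<in> hom C X Y\<rbrakk> \<Longrightarrow>
      amap F X Y f \<in> hom D (omap F X) (omap F Y)"
    and "X \<in> obj C \<Longrightarrow> amap F X X (idt C X) = idt D (omap F X)"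
    and "\<lbrakk>X \<in> obj C; Y \<in> obj C; Z \<in> obj C; f \<in> hom C X Y; g \<in> hom C Y Z\<rbrakk> \<Longrightarrow>
      amap F X Z (comp C X Y Z g f) =
        comp D (omap F X) (omap F Y) (omap F Z) (amap F Y Z g) (amap F X Y f)"
  using assms unfolding is_functor_def by blast+

lemma iso_arrow_cancel_left:
  assumes C: "is_category C" and X: "X \<in> obj C" and Y: "Y \<in> obj C" and Z: "Z \<in> obj C"
    and iso: "iso_arrow C Y Z m" and f: "f \<in> hom C X Y" and g: "g \<in> hom C X Y"
    and eq: "comp C X Y Z m f = comp C X Y Z m g"
  shows "f = g"
proof -
  from iso obtain n where m: "m \<in> hom C Y Z" and n: "n \<in> hom C Z Y"
    and nm: "comp C Y Z Y n m = idt C Y"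
    unfolding iso_arrow_def by blast
  have "comp C X Z Y n (comp C X Y Z m k) = k" if "k \<in> hom C X Y" for k
    using is_categoryD(5)[OF C X Y Z Y that m n] nm is_categoryD(4)[OF C X Y that] by simp
  from this[OF f] this[OF g] eq show ?thesis by metis
qed

lemma iso_arrow_cancel_right:
  assumes C: "is_category C" and X: "X \<in> obj C" and Y: "Y \<in> obj C" and Z: "Z \<in> obj C"
    and iso: "iso_arrow C X Y m" and f: "f \<in> hom C Y Z" and g: "g \<in> hom C Y Z"
    and eq: "comp C X Y Z f m = comp C X Y Z g m"
  shows "f = g"
proof -
  from iso obtain n where m: "m \<in> hom C X Y" and n: "n \<in> hom C Y X"
    and mn: "comp C Y X Y m n = idt C Y"
    unfolding iso_arrow_def by blast
  have "comp C Y X Z (comp C X Y Z k m) n = k" if "k \<in> hom C Y Z" for k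
    using is_categoryD(5)[OF C Y X Y Z n m that] mn is_categoryD(3)[OF C Y Z that] by simp
  from this[OF f] this[OF g] eq show ?thesis by metis
qed

text \<open>Naturality of \<open>\<eta>\<close> with invertible components makes \<open>F\<close>
  faithful, and \<open>\<epsilon>\<close> does the same for \<open>G\<close>. For fullness,
  \<open>amap G\<close> of an arrow \<open>k\<close> is conjugated by \<open>\<eta>\<close>, and
  faithfulness of \<open>G\<close> identifies the image of the result with \<open>k\<close>. The
  components of \<open>\<epsilon>\<close> themselves witness essential surjectivity.\<close>

lemma equivalence_full_faithful:
  assumes C: "is_category C" and D: "is_category D" and eqv: "equivalent_categories C D"
  obtains F where "is_functor C D F" "full_faithful C D F" "essentially_surjective C D F"
proof -
  from eqv obtain F G \<eta> \<epsilon> where F: "is_functor C D F" and G: "is_functor D C G"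
    and \<eta>: "natural_iso C C id_functor (comp_functor G F) \<eta>"
    and \<epsilon>: "natural_iso D D (comp_functor F G) id_functor \<epsilon>"
    unfolding equivalent_categories_def by blast
  note FO = is_functorD(1)[OF F] and FA = is_functorD(2)[OF F]
  note GO = is_functorD(1)[OF G] and GA = is_functorD(2)[OF G]
  have \<eta>_iso: "iso_arrow C X (omap G (omap F X)) (\<eta> X)" if "X \<in> obj C" for X
    using \<eta> that by (simp add: natural_iso_def id_functor_def comp_functor_def)
  have \<eta>_nat: "comp C X Y (omap G (omap F Y)) (\<eta> Y) f =
      comp C X (omap G (omap F X)) (omap G (omap F Y))
        (amap G (omap F X) (omap F Y) (amap F X Y f)) (\<eta> X)"
    if "X \<in> obj C" "Y \<in> obj C" "f \<in> hom C X Y" for X Y f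
    using \<eta> that by (simp add: natural_iso_def id_functor_def comp_functor_def)
  have \<epsilon>_iso: "iso_arrow D (omap F (omap G X)) X (\<epsilon> X)" if "X \<in> obj D" for X
    using \<epsilon> that by (simp add: natural_iso_def id_functor_def comp_functor_def)
  have \<epsilon>_nat: "comp D (omap F (omap G X)) (omap F (omap G Y)) Y (\<epsilon> Y)
        (amap F (omap G X) (omap G Y) (amap G X Y f)) =
      comp D (omap F (omap G X)) X Y f (\<epsilon> X)"
    if "X \<in> obj D" "Y \<in> obj D" "f \<in> hom D X Y" for X Y f
    using \<epsilon> that by (simp add: natural_iso_def id_functor_def comp_functor_def)
  have G_faithful: "f = g"
    if X: "X \<in> obj D" and Y: "Y \<in> obj D" and f: "f \<in> hom D X Y" and g: "g \<in> hom D X Y"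
      and eq: "amap G X Y f = amap G X Y g" for X Y f g
    by (rule iso_arrow_cancel_right[OF D FO[OF GO[OF X]] X Y \<epsilon>_iso[OF X] f g])
      (use \<epsilon>_nat[OF X Y f] \<epsilon>_nat[OF X Y g] eq in simp)
  have "bij_betw (amap F X Y) (hom C X Y) (hom D (omap F X) (omap F Y))"
    if X: "X \<in> obj C" and Y: "Y \<in> obj C" for X Y
  proof (intro bij_betw_imageI inj_onI subset_antisym image_subsetI subsetI)
    let ?GX = "omap G (omap F X)" and ?GY = "omap G (omap F Y)"
    note GX = GO[OF FO[OF X]] and GY = GO[OF FO[OF Y]]
    show "f = g" if f: "f \<in> hom C X Y" and g: "g \<in> hom C X Y"
      and eq: "amap F X Y f = amap F X Y g" for f g
      by (rule iso_arrow_cancel_left[OF C X Y GY \<eta>_iso[OF Y] f g])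
        (simp add: \<eta>_nat[OF X Y f] \<eta>_nat[OF X Y g] eq)
    show "amap F X Y f \<in> hom D (omap F X) (omap F Y)" if "f \<in> hom C X Y" for f
      using FA[OF X Y that] .
    show "k \<in> amap F X Y ` hom C X Y" if k: "k \<in> hom D (omap F X) (omap F Y)" for k
    proof -
      have Gk: "amap G (omap F X) (omap F Y) k \<in> hom C ?GX ?GY"
        using GA[OF FO[OF X] FO[OF Y] k] .
      have \<eta>X: "\<eta> X \<in> hom C X ?GX" and \<eta>Y: "\<eta> Y \<in> hom C Y ?GY"
        using \<eta>_iso[OF X] \<eta>_iso[OF Y] by (simp_all add: iso_arrow_def)
      obtain i where i: "i \<in> hom C ?GY Y" and \<eta>i: "comp C ?GY Y ?GY (\<eta> Y) i = idt C ?GY"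
        using \<eta>_iso[OF Y] unfolding iso_arrow_def by blast
      \<comment> \<open>The candidate preimage \<open>?f\<close> of \<open>k\<close> is forced by
        naturality: \<open>G k\<close> preceded by \<open>\<eta> X\<close> and followed by the
        inverse \<open>i\<close> of \<open>\<eta> Y\<close>.\<close>
      let ?l = "comp C X ?GX ?GY (amap G (omap F X) (omap F Y) k) (\<eta> X)"
      let ?f = "comp C X ?GY Y i ?l"
      have l: "?l \<in> hom C X ?GY" by (rule is_categoryD(2)[OF C X GX GY \<eta>X Gk])
      have f: "?f \<in> hom C X Y" by (rule is_categoryD(2)[OF C X GY Y l i])
      have "comp C X Y ?GY (\<eta> Y) ?f = ?l"
        using is_categoryD(5)[OF C X GY Y GY l i \<eta>Y] \<eta>i is_categoryD(4)[OF C X GY l] by simp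
      then have "comp C X ?GX ?GY (amap G (omap F X) (omap F Y) (amap F X Y ?f)) (\<eta> X) = ?l"
        using \<eta>_nat[OF X Y f] by simp
      then have "amap G (omap F X) (omap F Y) (amap F X Y ?f) = amap G (omap F X) (omap F Y) k"
        by (rule iso_arrow_cancel_right[OF C X GX GY \<eta>_iso[OF X]
              GA[OF FO[OF X] FO[OF Y] FA[OF X Y f]] Gk])
      then have "amap F X Y ?f = k"
        by (rule G_faithful[OF FO[OF X] FO[OF Y] FA[OF X Y f] k])
      then show ?thesis using f by (metis imageI)
    qed
  qed
  then have "full_faithful C D F" unfolding full_faithful_def by blast
  moreover have "essentially_surjective C D F"
    unfolding essentially_surjective_def using \<epsilon>_iso GO by blast
  ultimately show thesis using that F by blast
qed

section \<open>Subalgebras of MV-algebras\<close>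

lemma mv_subalgebra_carrier: "mv_algebra M \<Longrightarrow> mv_subalgebra M (mv_carrier M)"
  by (simp add: mv_subalgebra_def mv_algebra_def Let_def)

text \<open>The closure conditions survive intersections; the carrier is itself a member of the
  intersected family, which keeps the hull inside it.\<close>

lemma mv_subalgebra_hull:
  assumes "mv_algebra M" "X \<subseteq> mv_carrier M"
  shows "mv_subalgebra M (mv_subalgebra M hull X)"
  using mv_subalgebra_carrier[OF assms(1)] assms(2)
  unfolding mv_subalgebra_def hull_def by blast

lemma mv_algebra_restrict:
  assumes "mv_algebra M" "mv_subalgebra M N"
  shows "mv_algebra (M\<lparr>mv_carrier := N\<rparr>)"
  using assms by (simp add: mv_algebra_def mv_subalgebra_def Let_def subset_iff)

lemma finite_locally_finite_mv:
  assumes "mv_algebra M" "finite (mv_carrier M)"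
  shows "locally_finite_mv M"
  unfolding locally_finite_mv_def
  using assms mv_subalgebra_carrier[OF assms(1)]
  by (meson finite_subset hull_minimal)

lemma mv_hom_inclusion:
  assumes "mv_subalgebra M N"
  shows "restrict id N \<in> mv_hom (M\<lparr>mv_carrier := N\<rparr>) M"
  using assms by (auto simp: mv_hom_def mv_subalgebra_def)

lemma mv_hom_inclusion_sub:
  assumes "mv_subalgebra M N" "N \<subseteq> N'"
  shows "restrict id N \<in> mv_hom (M\<lparr>mv_carrier := N\<rparr>) (M\<lparr>mv_carrier := N'\<rparr>)"
  using assms by (auto simp: mv_hom_def mv_subalgebra_def)

lemma mv_hom_image_subalgebra:
  assumes "mv_algebra M" "f \<in> mv_hom M N"
  shows "mv_subalgebra N (f ` mv_carrier M)"
  unfolding mv_subalgebra_def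
proof (intro conjI ballI)
  have M: "mv_zero M \<in> mv_carrier M" "\<And>x. x \<in> mv_carrier M \<Longrightarrow> mv_neg M x \<in> mv_carrier M"
    "\<And>x y. x \<in> mv_carrier M \<Longrightarrow> y \<in> mv_carrier M \<Longrightarrow> mv_plus M x y \<in> mv_carrier M"
    using assms(1) by (auto simp: mv_algebra_def Let_def)
  have f: "f \<in> mv_carrier M \<rightarrow> mv_carrier N" "f (mv_zero M) = mv_zero N"
    "\<And>x. x \<in> mv_carrier M \<Longrightarrow> f (mv_neg M x) = mv_neg N (f x)"
    "\<And>x y. x \<in> mv_carrier M \<Longrightarrow> y \<in> mv_carrier M \<Longrightarrow> f (mv_plus M x y) = mv_plus N (f x) (f y)"
    using assms(2) by (auto simp: mv_hom_def)
  show "f ` mv_carrier M \<subseteq> mv_carrier N" using f(1) by (rule funcset_image)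
  show "mv_zero N \<in> f ` mv_carrier M" using M(1) by (auto simp: f(2)[symmetric])
  show "mv_neg N x \<in> f ` mv_carrier M" if "x \<in> f ` mv_carrier M" for x
    using that by (auto simp: f(3)[symmetric] M(2))
  show "mv_plus N x y \<in> f ` mv_carrier M" if "x \<in> f ` mv_carrier M" "y \<in> f ` mv_carrier M" for x y
    using that by (auto simp: f(4)[symmetric] M(3))
qed

lemma mv_hom_corestrict:
  assumes "f \<in> mv_hom M N" "f ` mv_carrier M \<subseteq> N'"
  shows "f \<in> mv_hom M (N\<lparr>mv_carrier := N'\<rparr>)"
  using assms by (auto simp: mv_hom_def PiE_iff)

lemma mv_hom_mem: "f \<in> mv_hom M N \<Longrightarrow> x \<in> mv_carrier M \<Longrightarrow> f x \<in> mv_carrier N"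
  by (auto simp: mv_hom_def)

section \<open>Finite Lukasiewicz chains\<close>

text \<open>The chain 0, 1/p, ..., 1 with truncated addition, scaled by \<open>p\<close> to the
  integers up to \<open>p\<close> and coded in \<open>'v\<close> along \<open>e\<close>. For
  injective \<open>e\<close>, \<open>inv e\<close> decodes an element to its index.\<close>

definition lukasiewicz :: "(nat \<Rightarrow> 'v) \<Rightarrow> nat \<Rightarrow> 'v mv_alg" where
  "lukasiewicz e p =
     \<lparr>mv_carrier = e ` {..p},
      mv_plus = (\<lambda>x y. e (min p (inv e x + inv e y))),
      mv_neg = (\<lambda>x. e (p - inv e x)),
      mv_zero = e 0\<rparr>"

lemma mv_algebra_lukasiewicz:
  assumes "inj e"
  shows "mv_algebra (lukasiewicz e p)"
proof -
  have assoc: "min p (min p (i + j) + k) = min p (i + min p (j + k))" for i j k by auto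
  \<comment> \<open>Both sides equal \<open>max i j\<close>.\<close>
  have comm: "min p (p - min p (p - i + j) + j) = min p (p - min p (p - j + i) + i)"
    if "i \<le> p" "j \<le> p" for i j using that by auto
  show ?thesis
    using assms assoc comm by (simp add: mv_algebra_def Let_def lukasiewicz_def)
qed

lemma two_element_subalgebra:
  assumes "inj e"
  shows "mv_subalgebra (lukasiewicz e p) {e 0, e p}"
  using assms by (auto simp: mv_subalgebra_def lukasiewicz_def)

text \<open>Let \<open>x\<close> be the least positive index occurring in \<open>B\<close>. The gap
  between \<open>p\<close> and the largest multiple of \<open>x\<close> strictly below
  \<open>p\<close> occurs as well, is positive and at most \<open>x\<close>, hence equals
  \<open>x\<close> by minimality. So \<open>x\<close> divides \<open>p\<close>: if
  \<open>x = 1\<close> the whole chain arises, if \<open>x = p\<close> only the two end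
  points.\<close>

lemma lukasiewicz_prime_subalgebra:
  assumes e: "inj e" and p: "prime p" and B: "mv_subalgebra (lukasiewicz e p) B"
  shows "B = {e 0, e p} \<or> B = e ` {..p}"
proof -
  define D where "D = {i. e i \<in> B}"
  have sub: "B \<subseteq> e ` {..p}" and D0: "0 \<in> D" and neg: "\<And>i. i \<in> D \<Longrightarrow> p - i \<in> D"
    using B e by (auto simp: mv_subalgebra_def lukasiewicz_def D_def)
  have "\<And>x y. x \<in> B \<Longrightarrow> y \<in> B \<Longrightarrow> e (min p (inv e x + inv e y)) \<in> B"
    using B by (simp add: mv_subalgebra_def lukasiewicz_def)
  from this[of "e i" "e j" for i j]
  have add: "\<And>i j. i \<in> D \<Longrightarrow> j \<in> D \<Longrightarrow> min p (i + j) \<in> D"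
    using e by (simp add: D_def)
  have B_eq: "B = e ` D" using sub by (auto simp: D_def)
  have D_le: "D \<subseteq> {..p}" using sub e by (auto simp: D_def inj_eq)
  have "p \<in> D" using neg[OF D0] by simp
  have "p > 0" using p by (simp add: prime_gt_0_nat)
  define x where "x = (LEAST i. i \<in> D \<and> i > 0)"
  have x: "x \<in> D" "x > 0" and least: "\<And>i. i \<in> D \<Longrightarrow> i > 0 \<Longrightarrow> x \<le> i"
    unfolding x_def using LeastI[of "\<lambda>i. i \<in> D \<and> i > 0" p] \<open>p \<in> D\<close> \<open>p > 0\<close>
    by (auto intro: Least_le)
  have mult: "min p (k * x) \<in> D" for k
  proof (induction k)
    case 0
    then show ?case using D0 by simp
  next
    case (Suc k)
    have "min p (Suc k * x) = min p (min p (k * x) + x)" by auto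
    then show ?case using add[OF Suc x(1)] by metis
  qed
  \<comment> \<open>Dividing \<open>p - 1\<close> instead of \<open>p\<close> keeps
    \<open>k * x\<close> strictly below \<open>p\<close>, so that the gap is positive even when
    \<open>x\<close> divides \<open>p\<close>.\<close>
  define k where "k = (p - 1) div x"
  have k1: "k * x < p"
    unfolding k_def using div_times_less_eq_dividend[of "p - 1" x] \<open>p > 0\<close> by linarith
  have "p - 1 < k * x + x"
    unfolding k_def using dividend_less_div_times[OF x(2), of "p - 1"] by linarith
  then have k2: "p - k * x \<le> x" by simp
  have "p - k * x \<in> D" using neg[OF mult[of k]] k1 by (simp add: min_def)
  then have "p - k * x = x" using least[of "p - k * x"] k1 k2 by simp
  then have "p = k * x + x" using k1 by simp
  then have "x dvd p" by simp
  then consider "x = 1" | "x = p" using p by (auto simp: prime_nat_iff)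
  then show ?thesis
  proof cases
    case 1
    have "i \<in> D" if "i \<le> p" for i using mult[of i] that by (simp add: 1 min_absorb2)
    then have "D = {..p}" using D_le by blast
    then show ?thesis using B_eq by simp
  next
    case 2
    have "i = 0 \<or> i = p" if "i \<in> D" for i using least[OF that] D_le that by (force simp: 2)
    then have "D = {0, p}" using D0 \<open>p \<in> D\<close> by blast
    then show ?thesis using B_eq by simp
  qed
qed

section \<open>Subalgebras in quasi-varieties\<close>

lemma set_universeD:
  assumes "set_universe small"
  shows "\<exists>A. small A \<and> infinite A"
    and "small A \<Longrightarrow> B \<subseteq> A \<Longrightarrow> small B"
    and "small A \<Longrightarrow> small (f ` A)"
  using assms unfolding set_universe_def by blast+

lemma tm_val_carrier_update: "tm_val (A\<lparr>carrier := U\<rparr>) \<rho> t = tm_val A \<rho> t"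
proof (induction t)
  case (App f ts)
  then show ?case by (simp cong: map_cong)
qed simp

text \<open>Quasi-equations are universal sentences: an assignment into \<open>U\<close> is one into
  the carriers of \<open>A\<close>, and terms keep their values. Smallness passes to
  subsets.\<close>

lemma quasi_variety_subalgebra:
  assumes univ: "set_universe small" and qv: "finitary_quasi_variety small S \<Sigma> K" and A: "A \<in> K"
    and sub: "\<And>s. s \<in> S \<Longrightarrow> U s \<subseteq> carrier A s"
    and closed: "\<And>f xs. f \<in> ops \<Sigma> \<Longrightarrow> list_all2 (\<lambda>x s. x \<in> U s) xs (insorts \<Sigma> f) \<Longrightarrow>
      interp A f xs \<in> U (outsort \<Sigma> f)"
  shows "A\<lparr>carrier := U\<rparr> \<in> K"
proof -
  from qv obtain E where K: "K = {A. sig_algebra small S \<Sigma> A \<and> (\<forall>q\<in>E. satisfies S A q)}"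
    unfolding finitary_quasi_variety_def by blast
  have "sig_algebra small S \<Sigma> (A\<lparr>carrier := U\<rparr>)"
    using A sub closed set_universeD(2)[OF univ]
    unfolding K sig_algebra_def args_def by auto
  moreover have "satisfies S (A\<lparr>carrier := U\<rparr>) q" if "q \<in> E" for q
  proof -
    have "satisfies S A q" using A that by (simp add: K)
    moreover have "\<rho> s \<in> vars q s \<rightarrow> carrier A s" if "s \<in> S" "\<rho> s \<in> vars q s \<rightarrow> U s" for \<rho> s
      using that sub by blast
    ultimately show ?thesis by (simp add: satisfies_def tm_val_carrier_update)
  qed
  ultimately show ?thesis by (simp add: K)
qed

text \<open>Preimages are chosen argument by argument. This pulls the arguments of an operation back
  along a homomorphism.\<close>

lemma list_all2_image_map2:
  assumes "list_all2 (\<lambda>x s. x \<in> h s ` C s) xs ss"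
  shows "\<exists>ys. list_all2 (\<lambda>y s. y \<in> C s) ys ss \<and> xs = map2 h ss ys"
  using assms
proof (induction xs ss rule: list_all2_induct)
  case (Cons x xs s ss)
  obtain y where y: "y \<in> C s" "x = h s y" using Cons(1) by (rule imageE) metis
  obtain ys where ys: "list_all2 (\<lambda>y s. y \<in> C s) ys ss" "xs = map2 h ss ys" using Cons by blast
  show ?case by (rule exI[of _ "y # ys"]) (simp add: y ys)
qed simp

lemma sig_hom_mem: "h \<in> sig_hom S \<Sigma> A B \<Longrightarrow> s \<in> S \<Longrightarrow> x \<in> carrier A s \<Longrightarrow> h s x \<in> carrier B s"
  by (auto simp: sig_hom_def PiE_iff)

text \<open>Homomorphisms take the value \<open>undefined\<close> outside \<open>S\<close> and
  outside the carriers of the source, so the carriers alone decide equality.\<close>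

lemma sig_hom_eqI:
  assumes "h \<in> sig_hom S \<Sigma> A B" "k \<in> sig_hom S \<Sigma> A C"
    and "\<And>s x. s \<in> S \<Longrightarrow> x \<in> carrier A s \<Longrightarrow> h s x = k s x"
  shows "h = k"
proof (rule ext)
  fix s
  show "h s = k s"
  proof (cases "s \<in> S")
    case True
    then have "h s \<in> extensional (carrier A s)" "k s \<in> extensional (carrier A s)"
      using assms(1,2) by (auto simp: sig_hom_def PiE_iff)
    then show ?thesis using assms(3)[OF True] by (rule extensionalityI)
  next
    case False
    then show ?thesis using assms(1,2) by (auto simp: sig_hom_def PiE_iff extensional_def)
  qed
qed

lemma sig_hom_corestrict:
  assumes "h \<in> sig_hom S \<Sigma> A B" "\<And>s x. s \<in> S \<Longrightarrow> x \<in> carrier A s \<Longrightarrow> h s x \<in> U s"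
  shows "h \<in> sig_hom S \<Sigma> A (B\<lparr>carrier := U\<rparr>)"
  using assms by (auto simp: sig_hom_def PiE_iff)

lemma sig_hom_inclusion:
  assumes sig: "finitary_signature S \<Sigma>" and sub: "\<And>s. s \<in> S \<Longrightarrow> U s \<subseteq> carrier A s"
    and closed: "\<And>f xs. f \<in> ops \<Sigma> \<Longrightarrow> list_all2 (\<lambda>x s. x \<in> U s) xs (insorts \<Sigma> f) \<Longrightarrow>
      interp A f xs \<in> U (outsort \<Sigma> f)"
  shows "(\<lambda>s\<in>S. restrict id (U s)) \<in> sig_hom S \<Sigma> (A\<lparr>carrier := U\<rparr>) A"
proof -
  let ?i = "\<lambda>s\<in>S. restrict id (U s)" and ?B = "A\<lparr>carrier := U\<rparr>"
  have "?i (outsort \<Sigma> f) (interp ?B f xs) = interp A f (map2 ?i (insorts \<Sigma> f) xs)"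
    if f: "f \<in> ops \<Sigma>" and xs: "xs \<in> args \<Sigma> ?B f" for f xs
  proof -
    have io: "set (insorts \<Sigma> f) \<subseteq> S" "outsort \<Sigma> f \<in> S"
      using sig f by (auto simp: finitary_signature_def)
    have "map2 ?i (insorts \<Sigma> f) xs = map2 (\<lambda>s x. x) (insorts \<Sigma> f) xs"
      by (rule map2_args_cong[OF xs io(1)]) simp
    also have "\<dots> = xs" by (rule map2_snd_args[OF xs])
    finally show ?thesis using closed[OF f] xs io by (simp add: args_def)
  qed
  moreover have "?i \<in> (\<Pi>\<^sub>E s\<in>S. carrier ?B s \<rightarrow>\<^sub>E carrier A s)" using sub by (auto simp: PiE_iff)
  ultimately show ?thesis unfolding sig_hom_def by blast
qed

text \<open>Applying \<open>h\<close> to the operation at the pulled-back arguments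
  \<open>?ys\<close> gives \<open>interp B f xs\<close>; undoing \<open>h\<close> on the output sort
  shows that the inverse commutes with the operation.\<close>

lemma sig_hom_inverse:
  assumes sig: "finitary_signature S \<Sigma>" and alg: "sig_algebra small S \<Sigma> A"
    and h: "h \<in> sig_hom S \<Sigma> A B"
    and bij: "\<And>s. s \<in> S \<Longrightarrow> bij_betw (h s) (carrier A s) (carrier B s)"
  shows "(\<lambda>s\<in>S. restrict (inv_into (carrier A s) (h s)) (carrier B s)) \<in> sig_hom S \<Sigma> B A"
proof -
  let ?k = "\<lambda>s\<in>S. restrict (inv_into (carrier A s) (h s)) (carrier B s)"
  have kmem: "?k s x \<in> carrier A s" if "s \<in> S" "x \<in> carrier B s" for s x
    using bij_betw_apply[OF bij_betw_inv_into[OF bij[OF that(1)]] that(2)] that by simp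
  have hk: "h s (?k s x) = x" if "s \<in> S" "x \<in> carrier B s" for s x
    using bij_betw_inv_into_right[OF bij[OF that(1)] that(2)] that by simp
  have kh: "?k s (h s x) = x" if "s \<in> S" "x \<in> carrier A s" for s x
    using bij_betw_inv_into_left[OF bij[OF that(1)] that(2)] that sig_hom_mem[OF h that] by simp
  have "?k (outsort \<Sigma> f) (interp B f xs) = interp A f (map2 ?k (insorts \<Sigma> f) xs)"
    if f: "f \<in> ops \<Sigma>" and xs: "xs \<in> args \<Sigma> B f" for f xs
  proof -
    have io: "set (insorts \<Sigma> f) \<subseteq> S" "outsort \<Sigma> f \<in> S"
      using sig f by (auto simp: finitary_signature_def)
    let ?ys = "map2 ?k (insorts \<Sigma> f) xs"
    have ys: "?ys \<in> args \<Sigma> A f" using args_map2[OF xs io(1)] kmem by blast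
    have "map2 h (insorts \<Sigma> f) ?ys = map2 (\<lambda>s x. x) (insorts \<Sigma> f) xs"
      unfolding map2_map2[OF xs] by (rule map2_args_cong[OF xs io(1)]) (rule hk)
    also have "\<dots> = xs" by (rule map2_snd_args[OF xs])
    finally have "h (outsort \<Sigma> f) (interp A f ?ys) = interp B f xs"
      using h f ys by (simp add: sig_hom_def)
    moreover have "interp A f ?ys \<in> carrier A (outsort \<Sigma> f)"
      using alg f ys by (simp add: sig_algebra_def)
    ultimately show ?thesis using kh[OF io(2)] by metis
  qed
  moreover have "?k \<in> (\<Pi>\<^sub>E s\<in>S. carrier B s \<rightarrow>\<^sub>E carrier A s)"
    using kmem by (simp add: PiE_iff)
  ultimately show ?thesis unfolding sig_hom_def by blast
qed

section \<open>Generators of a quasi-variety equivalent to locally finite MV-algebras\<close>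

text \<open>An equivalence enters only through one functor \<open>F\<close> out of the MV-algebras.
  The context ends with the conclusion that \<open>S\<close> is infinite.\<close>

locale lf_mv_quasi_variety =
  fixes small :: "'v set \<Rightarrow> bool"
    and S :: "'s set"
    and \<Sigma> :: "('o, 's) signature"
    and K :: "('o, 's, 'v) algebra set"
    and F :: "('v mv_alg, 'v \<Rightarrow> 'v, ('o, 's, 'v) algebra, 's \<Rightarrow> 'v \<Rightarrow> 'v) cat_functor"
  assumes universe: "set_universe small"
    and quasi_variety: "finitary_quasi_variety small S \<Sigma> K"
    and is_functor: "is_functor (lf_mv_category small) (algebra_category S \<Sigma> K) F"
    and full_faithful: "full_faithful (lf_mv_category small) (algebra_category S \<Sigma> K) F"
    and essentially_surjective:
      "essentially_surjective (lf_mv_category small) (algebra_category S \<Sigma> K) F"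
begin

section \<open>Action of the functor on carriers\<close>

definition lf :: "'v mv_alg \<Rightarrow> bool" where
  "lf M \<longleftrightarrow> small (mv_carrier M) \<and> locally_finite_mv M"

lemma lf_mv_algebra: "lf M \<Longrightarrow> mv_algebra M"
  by (simp add: lf_def locally_finite_mv_def)

lemma signature: "finitary_signature S \<Sigma>"
  using quasi_variety by (simp add: finitary_quasi_variety_def)

lemma sig_algebra: "A \<in> K \<Longrightarrow> sig_algebra small S \<Sigma> A"
  using quasi_variety unfolding finitary_quasi_variety_def by blast

lemma omap_mem: "lf M \<Longrightarrow> omap F M \<in> K"
  using is_functorD(1)[OF is_functor] by (simp add: lf_mv_category_def algebra_category_def lf_def)

lemma amap_hom:
  "lf M \<Longrightarrow> lf N \<Longrightarrow> f \<in> mv_hom M N \<Longrightarrow> amap F M N f \<in> sig_hom S \<Sigma> (omap F M) (omap F N)"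
  using is_functorD(2)[OF is_functor] by (simp add: lf_mv_category_def algebra_category_def lf_def)

lemma amap_mem:
  "lf M \<Longrightarrow> lf N \<Longrightarrow> f \<in> mv_hom M N \<Longrightarrow> s \<in> S \<Longrightarrow> x \<in> carrier (omap F M) s \<Longrightarrow>
    amap F M N f s x \<in> carrier (omap F N) s"
  using sig_hom_mem[OF amap_hom] .

lemma amap_id:
  "lf M \<Longrightarrow> s \<in> S \<Longrightarrow> x \<in> carrier (omap F M) s \<Longrightarrow>
    amap F M M (restrict id (mv_carrier M)) s x = x"
  using is_functorD(3)[OF is_functor, of M]
  by (simp add: lf_mv_category_def algebra_category_def lf_def)

lemma amap_comp:
  assumes "lf L" "lf M" "lf N" "f \<in> mv_hom L M" "g \<in> mv_hom M N"
    and "s \<in> S" "x \<in> carrier (omap F L) s"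
  shows "amap F L N (compose (mv_carrier L) g f) s x = amap F M N g s (amap F L M f s x)"
  using is_functorD(4)[OF is_functor, of L M N f g] assms
  by (simp add: lf_mv_category_def algebra_category_def lf_def compose_eq)

lemma amap_faithful:
  assumes M: "lf M" and N: "lf N" and f: "f \<in> mv_hom M N" and g: "g \<in> mv_hom M N"
    and eq: "\<And>s x. s \<in> S \<Longrightarrow> x \<in> carrier (omap F M) s \<Longrightarrow> amap F M N f s x = amap F M N g s x"
  shows "f = g"
proof -
  have "amap F M N f = amap F M N g"
    by (rule sig_hom_eqI[OF amap_hom[OF M N f] amap_hom[OF M N g] eq])
  moreover have "inj_on (amap F M N) (mv_hom M N)"
    using full_faithful M N
    by (simp add: full_faithful_def lf_mv_category_def lf_def bij_betw_def)
  ultimately show ?thesis using f g by (simp add: inj_on_eq_iff)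
qed

lemma amap_full:
  assumes M: "lf M" and N: "lf N" and h: "h \<in> sig_hom S \<Sigma> (omap F M) (omap F N)"
  obtains f where "f \<in> mv_hom M N" "amap F M N f = h"
proof -
  have "amap F M N ` mv_hom M N = sig_hom S \<Sigma> (omap F M) (omap F N)"
    using full_faithful M N
    by (simp add: full_faithful_def lf_mv_category_def algebra_category_def lf_def bij_betw_def)
  then have "h \<in> amap F M N ` mv_hom M N" using h by simp
  then show thesis using that by blast
qed

lemma sig_hom_compose:
  assumes "A \<in> K" "B \<in> K" "C \<in> K" "f \<in> sig_hom S \<Sigma> A B" "g \<in> sig_hom S \<Sigma> B C"
  shows "(\<lambda>s\<in>S. compose (carrier A s) (g s) (f s)) \<in> sig_hom S \<Sigma> A C"
  using is_categoryD(2)[OF is_category_algebra_category[OF quasi_variety], of A B C f g] assms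
  by (simp add: algebra_category_def)

lemma preimage:
  assumes "A \<in> K"
  obtains M \<theta> \<theta>' where "lf M" "\<theta> \<in> sig_hom S \<Sigma> (omap F M) A" "\<theta>' \<in> sig_hom S \<Sigma> A (omap F M)"
    "\<And>s x. s \<in> S \<Longrightarrow> x \<in> carrier (omap F M) s \<Longrightarrow> \<theta>' s (\<theta> s x) = x"
    "\<And>s x. s \<in> S \<Longrightarrow> x \<in> carrier A s \<Longrightarrow> \<theta> s (\<theta>' s x) = x"
proof -
  from essentially_surjective assms obtain M \<theta> where M: "lf M"
    and "iso_arrow (algebra_category S \<Sigma> K) (omap F M) A \<theta>"
    unfolding essentially_surjective_def
    by (auto simp: lf_mv_category_def algebra_category_def lf_def)
  then obtain \<theta>' where \<theta>: "\<theta> \<in> sig_hom S \<Sigma> (omap F M) A" "\<theta>' \<in> sig_hom S \<Sigma> A (omap F M)"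
    and id1: "(\<lambda>s\<in>S. compose (carrier (omap F M) s) (\<theta>' s) (\<theta> s)) =
      (\<lambda>s\<in>S. restrict id (carrier (omap F M) s))"
    and id2: "(\<lambda>s\<in>S. compose (carrier A s) (\<theta> s) (\<theta>' s)) = (\<lambda>s\<in>S. restrict id (carrier A s))"
    unfolding iso_arrow_def by (auto simp: algebra_category_def)
  have "\<theta>' s (\<theta> s x) = x" if "s \<in> S" "x \<in> carrier (omap F M) s" for s x
    using fun_cong[OF fun_cong[OF id1, of s], of x] that by (simp add: compose_eq)
  moreover have "\<theta> s (\<theta>' s x) = x" if "s \<in> S" "x \<in> carrier A s" for s x
    using fun_cong[OF fun_cong[OF id2, of s], of x] that by (simp add: compose_eq)
  ultimately show thesis by (rule that[OF M \<theta>])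
qed

text \<open>The sortwise inverse is a homomorphism, so fullness lifts it to some \<open>g\<close>.
  Faithfulness turns the identity on the side of \<open>K\<close> into \<open>f\<close> after
  \<open>g\<close> being the identity, and a map with a right inverse is onto.\<close>

lemma bijective_amap_surjective:
  assumes M: "lf M" and N: "lf N" and f: "f \<in> mv_hom M N"
    and bij: "\<And>s. s \<in> S \<Longrightarrow> bij_betw (amap F M N f s) (carrier (omap F M) s) (carrier (omap F N) s)"
  shows "f ` mv_carrier M = mv_carrier N"
proof -
  let ?k = "\<lambda>s\<in>S. restrict (inv_into (carrier (omap F M) s) (amap F M N f s)) (carrier (omap F N) s)"
  obtain g where g: "g \<in> mv_hom N M" and Fg: "amap F N M g = ?k"
    by (rule amap_full[OF N M sig_hom_inverse[OF signature sig_algebra[OF omap_mem[OF M]]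
          amap_hom[OF M N f] bij]])
  have fg: "compose (mv_carrier N) f g \<in> mv_hom N N"
    using is_categoryD(2)[OF is_category_lf_mv[of small], of N M N g f] M N f g
    by (simp add: lf_mv_category_def lf_def)
  have id: "restrict id (mv_carrier N) \<in> mv_hom N N"
    using is_categoryD(1)[OF is_category_lf_mv[of small], of N] N
    by (simp add: lf_mv_category_def lf_def)
  have "compose (mv_carrier N) f g = restrict id (mv_carrier N)"
  proof (rule amap_faithful[OF N N fg id])
    fix s x
    assume s: "s \<in> S" and x: "x \<in> carrier (omap F N) s"
    show "amap F N N (compose (mv_carrier N) f g) s x = amap F N N (restrict id (mv_carrier N)) s x"
      using bij_betw_inv_into_right[OF bij[OF s] x] s x
      by (simp add: amap_comp[OF N M N g f s x] amap_id[OF N s x] Fg)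
  qed
  then have "f (g x) = x" if "x \<in> mv_carrier N" for x
    using fun_cong[of _ _ x] that by (metis compose_eq id_apply restrict_apply')
  then show ?thesis using mv_hom_mem[OF f] mv_hom_mem[OF g] by (metis image_eqI image_subsetI subset_antisym subsetI)
qed

text \<open>Here \<open>u\<close> is a universal element in the sense of Yoneda: \<open>P\<close>
  represents the functor sending \<open>M\<close> to the elements of sort \<open>s\<close> of
  \<open>omap F M\<close>. This expresses freeness on one generator of sort \<open>s\<close> in
  terms of MV-homomorphisms.\<close>

definition represents :: "'s \<Rightarrow> 'v mv_alg \<Rightarrow> 'v \<Rightarrow> bool" where
  "represents s P u \<longleftrightarrow> lf P \<and> u \<in> carrier (omap F P) s \<and>
     (\<forall>M. lf M \<longrightarrow> bij_betw (\<lambda>f. amap F P M f s u) (mv_hom P M) (carrier (omap F M) s))"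

lemma representsD:
  assumes "represents s P u"
  shows "lf P" and "u \<in> carrier (omap F P) s"
    and "lf M \<Longrightarrow> y \<in> carrier (omap F M) s \<Longrightarrow> \<exists>f\<in>mv_hom P M. amap F P M f s u = y"
    and "lf M \<Longrightarrow> f \<in> mv_hom P M \<Longrightarrow> g \<in> mv_hom P M \<Longrightarrow>
      amap F P M f s u = amap F P M g s u \<Longrightarrow> f = g"
proof -
  show "lf P" "u \<in> carrier (omap F P) s" using assms by (simp_all add: represents_def)
  have bij: "bij_betw (\<lambda>f. amap F P M f s u) (mv_hom P M) (carrier (omap F M) s)" if "lf M" for M
    using assms that by (simp add: represents_def)
  show "\<exists>f\<in>mv_hom P M. amap F P M f s u = y" if "lf M" "y \<in> carrier (omap F M) s"
    using bij_betw_imp_surj_on[OF bij[OF that(1)]] that(2) by (metis (no_types, lifting) imageE)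
  show "f = g" if "lf M" "f \<in> mv_hom P M" "g \<in> mv_hom P M"
    "amap F P M f s u = amap F P M g s u"
    using inj_onD[OF bij_betw_imp_inj_on[OF bij[OF that(1)]] that(4,2,3)] .
qed

text \<open>Homomorphisms from the free algebra on one generator of sort \<open>s\<close> correspond
  to elements of sort \<open>s\<close>. An isomorphism \<open>\<theta>\<close> moves this property
  to an algebra \<open>omap F P\<close>, and since \<open>F\<close> is full and faithful,
  homomorphisms from there are MV-homomorphisms from \<open>P\<close>.\<close>

lemma representable:
  assumes s: "s \<in> S"
  shows "\<exists>P u. represents s P u"
proof -
  \<comment> \<open>One generator of sort \<open>s\<close> and none of any other sort;
    \<open>undefined\<close> merely names it.\<close>
  define X where "X t = (if t = s then {undefined :: 'v} else {})" for t
  have "small (X t)" for t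
  proof -
    obtain A where "small A" "infinite A" using set_universeD(1)[OF universe] by blast
    then have "small ((\<lambda>_. undefined) ` A)" "A \<noteq> {}" using set_universeD(3)[OF universe] by auto
    moreover from this have "X t \<subseteq> (\<lambda>_. undefined) ` A" by (auto simp: X_def)
    ultimately show ?thesis using set_universeD(2)[OF universe] by blast
  qed
  then obtain A \<xi> where free: "free_algebra S \<Sigma> K X A \<xi>"
    using quasi_variety unfolding finitary_quasi_variety_def by blast
  define a where "a = \<xi> s undefined"
  have A: "A \<in> K" using free by (simp add: free_algebra_def)
  have a: "a \<in> carrier A s" using free s by (force simp: free_algebra_def a_def X_def)
  have univ: "\<exists>!h. h \<in> sig_hom S \<Sigma> A B \<and> h s a = y" if B: "B \<in> K" and y: "y \<in> carrier B s" for B y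
  proof -
    have ext: "\<forall>\<phi>. (\<forall>t\<in>S. \<phi> t \<in> X t \<rightarrow> carrier B t) \<longrightarrow>
        (\<exists>!h. h \<in> sig_hom S \<Sigma> A B \<and> (\<forall>t\<in>S. \<forall>x\<in>X t. h t (\<xi> t x) = \<phi> t x))"
      using free B unfolding free_algebra_def by (elim conjE) (erule (1) bspec)
    have "\<forall>t\<in>S. (\<lambda>_. y) \<in> X t \<rightarrow> carrier B t" using y by (auto simp: X_def)
    with ext[rule_format, of "\<lambda>_ _. y"]
    have "\<exists>!h. h \<in> sig_hom S \<Sigma> A B \<and> (\<forall>t\<in>S. \<forall>x\<in>X t. h t (\<xi> t x) = y)"
      by simp
    moreover have "(\<forall>t\<in>S. \<forall>x\<in>X t. h t (\<xi> t x) = y) \<longleftrightarrow> h s a = y" for h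
      using s by (auto simp: X_def a_def)
    ultimately show ?thesis by simp
  qed
  obtain P \<theta> \<theta>' where P: "lf P" and \<theta>: "\<theta> \<in> sig_hom S \<Sigma> (omap F P) A"
    and \<theta>': "\<theta>' \<in> sig_hom S \<Sigma> A (omap F P)"
    and \<theta>'\<theta>: "\<And>s x. s \<in> S \<Longrightarrow> x \<in> carrier (omap F P) s \<Longrightarrow> \<theta>' s (\<theta> s x) = x"
    and \<theta>\<theta>': "\<And>s x. s \<in> S \<Longrightarrow> x \<in> carrier A s \<Longrightarrow> \<theta> s (\<theta>' s x) = x"
    by (rule preimage[OF A]) (rule that; assumption)
  note FP = omap_mem[OF P]
  define u where "u = \<theta>' s a"
  have u: "u \<in> carrier (omap F P) s" unfolding u_def by (rule sig_hom_mem[OF \<theta>' s a])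
  have \<theta>u: "\<theta> s u = a" unfolding u_def by (rule \<theta>\<theta>'[OF s a])
  have "bij_betw (\<lambda>f. amap F P M f s u) (mv_hom P M) (carrier (omap F M) s)" if M: "lf M" for M
  proof (intro bij_betw_imageI inj_onI subset_antisym image_subsetI subsetI)
    fix y
    assume y: "y \<in> carrier (omap F M) s"
    obtain h where h: "h \<in> sig_hom S \<Sigma> A (omap F M)" "h s a = y"
      using univ[OF omap_mem[OF M] y] by blast
    obtain f where "f \<in> mv_hom P M"
      "amap F P M f = (\<lambda>s\<in>S. compose (carrier (omap F P) s) (h s) (\<theta> s))"
      by (rule amap_full[OF P M sig_hom_compose[OF FP A omap_mem[OF M] \<theta> h(1)]])
    then show "y \<in> (\<lambda>f. amap F P M f s u) ` mv_hom P M"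
      using s u h(2) \<theta>u by (intro image_eqI[of _ _ f]) (simp_all add: compose_eq)
  next
    fix f assume "f \<in> mv_hom P M"
    then show "amap F P M f s u \<in> carrier (omap F M) s" by (rule amap_mem[OF P M _ s u])
  next
    fix f g
    assume f: "f \<in> mv_hom P M" and g: "g \<in> mv_hom P M"
      and eq: "amap F P M f s u = amap F P M g s u"
    \<comment> \<open>Precomposition with \<open>\<theta>'\<close> turns \<open>f\<close> and
      \<open>g\<close> into homomorphisms from the free algebra \<open>A\<close> that agree on its
      generator \<open>a\<close>.\<close>
    let ?c = "\<lambda>f. \<lambda>s\<in>S. compose (carrier A s) (amap F P M f s) (\<theta>' s)"
    have c: "?c f \<in> sig_hom S \<Sigma> A (omap F M)" if "f \<in> mv_hom P M" for f
      by (rule sig_hom_compose[OF A FP omap_mem[OF M] \<theta>' amap_hom[OF P M that]])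
    have ca: "?c f s a = amap F P M f s u" for f
      using s a by (simp add: compose_eq u_def)
    have y: "amap F P M f s u \<in> carrier (omap F M) s" by (rule amap_mem[OF P M f s u])
    obtain h where uniq: "\<And>k. k \<in> sig_hom S \<Sigma> A (omap F M) \<and> k s a = amap F P M f s u \<Longrightarrow> k = h"
      using univ[OF omap_mem[OF M] y] by (elim ex1E) blast
    have "?c f = h" by (rule uniq) (rule conjI[OF c[OF f] ca])
    moreover have "?c g = h" by (rule uniq) (rule conjI[OF c[OF g] ca[of g, folded eq]])
    ultimately have c_eq: "?c f = ?c g" by (rule trans[OF _ sym])
    show "f = g"
    proof (rule amap_faithful[OF P M f g])
      fix t x
      assume t: "t \<in> S" and x: "x \<in> carrier (omap F P) t"
      show "amap F P M f t x = amap F P M g t x"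
        using fun_cong[OF fun_cong[OF c_eq, of t], of "\<theta> t x"] t sig_hom_mem[OF \<theta> t x] \<theta>'\<theta>[OF t x]
        by (simp add: compose_eq)
    qed
  qed
  then show ?thesis using P u unfolding represents_def by blast
qed

section \<open>Elements supported on finite subalgebras\<close>

abbreviation sub :: "'v mv_alg \<Rightarrow> 'v set \<Rightarrow> 'v mv_alg" where
  "sub M N \<equiv> M\<lparr>mv_carrier := N\<rparr>"

lemma lf_finite_sub:
  assumes M: "lf M" and N: "mv_subalgebra M N" "finite N"
  shows "lf (sub M N)"
proof -
  have "small N"
    using set_universeD(2)[OF universe] M N(1) by (auto simp: lf_def mv_subalgebra_def)
  moreover have "locally_finite_mv (sub M N)"
    using mv_algebra_restrict[OF lf_mv_algebra[OF M] N(1)] N(2)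
    by (simp add: finite_locally_finite_mv)
  ultimately show ?thesis by (simp add: lf_def)
qed

lemma mv_hom_compose:
  assumes "lf L" "lf M" "lf N" "f \<in> mv_hom L M" "g \<in> mv_hom M N"
  shows "compose (mv_carrier L) g f \<in> mv_hom L N"
  using is_categoryD(2)[OF is_category_lf_mv[of small], of L M N f g] assms
  by (simp add: lf_mv_category_def lf_def)

text \<open>The elements of \<open>omap F M\<close> coming from finite subalgebras of \<open>M\<close> form a subalgebra, since
  the operations are finitary. It lies in \<open>K\<close>, so it is \<open>omap F V\<close> for a monomorphism \<open>m\<close> from some
  \<open>V\<close> to \<open>M\<close> through which every inclusion of a finite subalgebra factors. As \<open>M\<close> is the directed
  union of its finite subalgebras, \<open>m\<close> splits. Directed colimits in \<open>K\<close> cannot be computed on the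
  carriers here, because the quasi-equations may have infinitely many premises.\<close>

lemma finite_support:
  assumes M: "lf M" and s: "s \<in> S" and u: "u \<in> carrier (omap F M) s"
  shows "\<exists>N v. mv_subalgebra M N \<and> finite N \<and> v \<in> carrier (omap F (sub M N)) s \<and>
    amap F (sub M N) M (restrict id N) s v = u"
proof -

  \<comment> \<open>Images of finite subalgebras under the functor\<close>
  define fin where "fin N \<longleftrightarrow> mv_subalgebra M N \<and> finite N" for N
  define inc where "inc N = amap F (sub M N) M (restrict id N)" for N
  define R where "R N s = inc N s ` carrier (omap F (sub M N)) s" for N s
  define U where "U s = (\<Union>N\<in>Collect fin. R N s)" for s
  note alg = lf_mv_algebra[OF M] and FM = omap_mem[OF M]
  have lf_sub: "lf (sub M N)" if "fin N" for N
    using that lf_finite_sub[OF M] by (simp add: fin_def)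
  have fin_sub: "N \<subseteq> mv_carrier M" if "fin N" for N
    using that by (simp add: fin_def mv_subalgebra_def)
  have hom_inc: "restrict id N \<in> mv_hom (sub M N) M" if "fin N" for N
    by (rule mv_hom_inclusion) (use that in \<open>simp add: fin_def\<close>)
  have hom_inc_sub: "restrict id N \<in> mv_hom (sub M N) (sub M N')" if "fin N" "N \<subseteq> N'" for N N'
    by (rule mv_hom_inclusion_sub) (use that in \<open>simp_all add: fin_def\<close>)
  have inc_hom: "inc N \<in> sig_hom S \<Sigma> (omap F (sub M N)) (omap F M)" if "fin N" for N
    unfolding inc_def by (rule amap_hom[OF lf_sub[OF that] M hom_inc[OF that]])
  have fin_hull: "fin (mv_subalgebra M hull X)" if "finite X" "X \<subseteq> mv_carrier M" for X
    using that M mv_subalgebra_hull[OF alg] by (simp add: fin_def lf_def locally_finite_mv_def)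
  \<comment> \<open>Local finiteness is what keeps the subalgebra generated by two finite ones
    finite.\<close>
  have directed: "\<exists>N. fin N \<and> N1 \<subseteq> N \<and> N2 \<subseteq> N" if "fin N1" "fin N2" for N1 N2
  proof (intro exI conjI)
    show "fin (mv_subalgebra M hull (N1 \<union> N2))"
      using that fin_sub by (intro fin_hull) (auto simp: fin_def)
    show "N1 \<subseteq> mv_subalgebra M hull (N1 \<union> N2)" "N2 \<subseteq> mv_subalgebra M hull (N1 \<union> N2)"
      using hull_subset[of "N1 \<union> N2"] by blast+
  qed
  have R_mono: "R N t \<subseteq> R N' t" if N: "fin N" and N': "fin N'" and "N \<subseteq> N'" and t: "t \<in> S" for N N' t
  proof
    fix y assume "y \<in> R N t"
    then obtain x where x: "x \<in> carrier (omap F (sub M N)) t" and y: "y = inc N t x"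
      unfolding R_def by blast
    have "compose N (restrict id N') (restrict id N) = restrict id N"
      using \<open>N \<subseteq> N'\<close> by (auto simp: compose_def intro!: restrict_ext)
    then have "y = inc N' t (amap F (sub M N) (sub M N') (restrict id N) t x)"
      using amap_comp[OF lf_sub[OF N] lf_sub[OF N'] M hom_inc_sub[OF N \<open>N \<subseteq> N'\<close>] hom_inc[OF N'] t x]
      by (simp add: y inc_def)
    then show "y \<in> R N' t"
      unfolding R_def
      using amap_mem[OF lf_sub[OF N] lf_sub[OF N'] hom_inc_sub[OF N \<open>N \<subseteq> N'\<close>] t x] by (rule image_eqI)
  qed
  \<comment> \<open>Here finite arity is decisive: finitely many arguments, each coming from some
    finite subalgebra, all come from a common one.\<close>
  have common: "\<exists>N. fin N \<and> list_all2 (\<lambda>x s. x \<in> R N s) xs ss"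
    if "list_all2 (\<lambda>x s. x \<in> U s) xs ss" "set ss \<subseteq> S" for xs ss
    using that
  proof (induction xs ss rule: list_all2_induct)
    case Nil
    have "fin (mv_subalgebra M hull {})" by (rule fin_hull) simp_all
    then show ?case by auto
  next
    case (Cons x xs t ss)
    obtain N1 where N1: "fin N1" "x \<in> R N1 t" using Cons(1) by (auto simp: U_def)
    obtain N2 where N2: "fin N2" "list_all2 (\<lambda>x s. x \<in> R N2 s) xs ss" using Cons by auto
    obtain N where N: "fin N" "N1 \<subseteq> N" "N2 \<subseteq> N" using directed[OF N1(1) N2(1)] by blast
    have "x \<in> R N t" using R_mono[OF N1(1) N(1,2)] N1(2) Cons(4) by auto
    moreover have "list_all2 (\<lambda>x s. x \<in> R N s) xs ss"
      using R_mono[OF N2(1) N(1,3)] N2(2) Cons(4)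
      by (auto simp: list_all2_conv_all_nth subset_iff)
    ultimately show ?case using N(1) by auto
  qed
  have U_sub: "U t \<subseteq> carrier (omap F M) t" if "t \<in> S" for t
    using sig_hom_mem[OF inc_hom that] by (auto simp: U_def R_def)
  have closed: "interp (omap F M) f xs \<in> U (outsort \<Sigma> f)"
    if f: "f \<in> ops \<Sigma>" and xs: "list_all2 (\<lambda>x s. x \<in> U s) xs (insorts \<Sigma> f)" for f xs
  proof -
    have "set (insorts \<Sigma> f) \<subseteq> S" using signature f by (simp add: finitary_signature_def)
    then obtain N where N: "fin N" and "list_all2 (\<lambda>x s. x \<in> R N s) xs (insorts \<Sigma> f)"
      using common[OF xs] by blast
    then obtain ys where ys: "ys \<in> args \<Sigma> (omap F (sub M N)) f"
      and "xs = map2 (inc N) (insorts \<Sigma> f) ys"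
      using list_all2_image_map2[of "inc N" "carrier (omap F (sub M N))"]
      unfolding R_def args_def by blast
    then have "interp (omap F M) f xs =
        inc N (outsort \<Sigma> f) (interp (omap F (sub M N)) f ys)"
      using inc_hom[OF N] f by (simp add: sig_hom_def)
    moreover have "interp (omap F (sub M N)) f ys \<in> carrier (omap F (sub M N)) (outsort \<Sigma> f)"
      using sig_algebra[OF omap_mem[OF lf_sub[OF N]]] f ys by (simp add: sig_algebra_def)
    ultimately show ?thesis using N by (auto simp: U_def R_def)
  qed

  \<comment> \<open>The algebra of finitely supported elements and its arrow to
    \<open>M\<close>\<close>
  define A where "A = (omap F M)\<lparr>carrier := U\<rparr>"
  have carrier_A: "carrier A = U" by (simp add: A_def)
  have A: "A \<in> K"
    unfolding A_def by (rule quasi_variety_subalgebra[OF universe quasi_variety FM U_sub closed])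
  obtain V \<theta> \<theta>' where V: "lf V" and \<theta>: "\<theta> \<in> sig_hom S \<Sigma> (omap F V) A"
    and \<theta>': "\<theta>' \<in> sig_hom S \<Sigma> A (omap F V)"
    and \<theta>'\<theta>: "\<And>s x. s \<in> S \<Longrightarrow> x \<in> carrier (omap F V) s \<Longrightarrow> \<theta>' s (\<theta> s x) = x"
    and \<theta>\<theta>': "\<And>s x. s \<in> S \<Longrightarrow> x \<in> carrier A s \<Longrightarrow> \<theta> s (\<theta>' s x) = x"
    by (rule preimage[OF A]) (rule that; assumption)
  note FV = omap_mem[OF V]
  have \<theta>_mem: "\<theta> t x \<in> U t" if "t \<in> S" "x \<in> carrier (omap F V) t" for t x
    using sig_hom_mem[OF \<theta> that] by (simp add: carrier_A)
  \<comment> \<open>By fullness, \<open>\<theta>\<close> followed by the inclusion of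
    \<open>A\<close> is the image of an arrow \<open>m\<close>; on elements of
    \<open>omap F V\<close> it acts as \<open>\<theta>\<close>.\<close>
  obtain m where m: "m \<in> mv_hom V M" and Fm: "amap F V M m =
      (\<lambda>s\<in>S. compose (carrier (omap F V) s) ((\<lambda>s\<in>S. restrict id (U s)) s) (\<theta> s))"
    by (rule amap_full[OF V M sig_hom_compose[OF FV A FM \<theta>
          sig_hom_inclusion[OF signature U_sub closed, folded A_def]]])
  have Fm: "amap F V M m t x = \<theta> t x" if "t \<in> S" "x \<in> carrier (omap F V) t" for t x
    using that \<theta>_mem by (simp add: Fm compose_eq)
  \<comment> \<open>The image of \<open>m\<close> under \<open>F\<close> is injective on every sort,
    because \<open>\<theta>\<close> has the left inverse \<open>\<theta>'\<close>. Faithfulness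
    turns this into left cancellation of \<open>m\<close>.\<close>
  have m_mono: "f = g"
    if L: "lf L" and f: "f \<in> mv_hom L V" and g: "g \<in> mv_hom L V"
      and eq: "\<And>x. x \<in> mv_carrier L \<Longrightarrow> m (f x) = m (g x)" for L f g
  proof (rule amap_faithful[OF L V f g])
    fix t x
    assume t: "t \<in> S" and x: "x \<in> carrier (omap F L) t"
    have "compose (mv_carrier L) m f = compose (mv_carrier L) m g"
      unfolding compose_def using eq by (rule restrict_ext)
    then have "\<theta> t (amap F L V f t x) = \<theta> t (amap F L V g t x)"
      using amap_comp[OF L V M f m t x] amap_comp[OF L V M g m t x]
        Fm[OF t amap_mem[OF L V f t x]] Fm[OF t amap_mem[OF L V g t x]] by metis
    then show "amap F L V f t x = amap F L V g t x"
      using \<theta>'\<theta>[OF t amap_mem[OF L V f t x]] \<theta>'\<theta>[OF t amap_mem[OF L V g t x]] by metis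
  qed
  \<comment> \<open>The image of \<open>inc N\<close> lies in \<open>U\<close>, so
    \<open>inc N\<close> factors through \<open>A\<close>; following it by \<open>\<theta>'\<close>
    and lifting along \<open>F\<close> gives the required \<open>g\<close>.\<close>
  have "\<exists>g\<in>mv_hom (sub M N) V. \<forall>x\<in>N. m (g x) = x" if N: "fin N" for N
  proof -
    note lfN = lf_sub[OF N]
    have incA: "inc N \<in> sig_hom S \<Sigma> (omap F (sub M N)) A"
      unfolding A_def by (rule sig_hom_corestrict[OF inc_hom[OF N]]) (use N in \<open>auto simp: U_def R_def\<close>)
    obtain g where g: "g \<in> mv_hom (sub M N) V" and Fg: "amap F (sub M N) V g =
        (\<lambda>s\<in>S. compose (carrier (omap F (sub M N)) s) (\<theta>' s) (inc N s))"
      by (rule amap_full[OF lfN V sig_hom_compose[OF omap_mem[OF lfN] A FV incA \<theta>']])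
    have mg: "compose N m g \<in> mv_hom (sub M N) M"
      using mv_hom_compose[OF lfN V M g m] by simp
    have mg_eq: "compose N m g = restrict id N"
    proof (rule amap_faithful[OF lfN M mg hom_inc[OF N]])
      fix t x
      assume t: "t \<in> S" and x: "x \<in> carrier (omap F (sub M N)) t"
      show "amap F (sub M N) M (compose N m g) t x = amap F (sub M N) M (restrict id N) t x"
        using amap_comp[OF lfN V M g m t x] Fm[OF t amap_mem[OF lfN V g t x]] t x
          \<theta>\<theta>'[OF t sig_hom_mem[OF incA t x]]
        by (simp add: Fg compose_eq inc_def)
    qed
    have "m (g x) = x" if "x \<in> N" for x
      using fun_cong[OF mg_eq, of x] that by (simp add: compose_eq)
    then show ?thesis using g by blast
  qed

  \<comment> \<open>Gluing the factorizations into a right inverse of \<open>m\<close>\<close>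
  then obtain g where g: "\<And>N. fin N \<Longrightarrow> g N \<in> mv_hom (sub M N) V"
    and mg: "\<And>N x. fin N \<Longrightarrow> x \<in> N \<Longrightarrow> m (g N x) = x"
    by metis
  \<comment> \<open>After \<open>m\<close> both maps become the inclusion of \<open>N\<close>, and
    \<open>m\<close> can be cancelled.\<close>
  have g_coherent: "g N' x = g N x" if N: "fin N" and N': "fin N'" and sub: "N \<subseteq> N'" and x: "x \<in> N" for N N' x
  proof -
    have h: "compose N (g N') (restrict id N) \<in> mv_hom (sub M N) V"
      using mv_hom_compose[OF lf_sub[OF N] lf_sub[OF N'] V hom_inc_sub[OF N sub] g[OF N']] by simp
    have eq: "compose N (g N') (restrict id N) = g N"
      by (rule m_mono[OF lf_sub[OF N] h g[OF N]])
        (use mg[OF N] mg[OF N'] sub in \<open>auto simp: compose_eq\<close>)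
    show ?thesis using fun_cong[OF eq, of x] x by (simp add: compose_eq)
  qed
  \<comment> \<open>The subalgebra generated by \<open>x\<close> lies in every \<open>N\<close>
    containing \<open>x\<close>, so by coherence its map gives the common value of all
    \<open>g N\<close> at \<open>x\<close>.\<close>
  define r where "r = (\<lambda>x\<in>mv_carrier M. g (mv_subalgebra M hull {x}) x)"
  have r_eq: "r x = g N x" if N: "fin N" and x: "x \<in> N" for N x
  proof -
    have xM: "x \<in> mv_carrier M" using fin_sub[OF N] x by blast
    have "mv_subalgebra M hull {x} \<subseteq> N"
      by (rule hull_minimal) (use N x in \<open>simp_all add: fin_def\<close>)
    moreover have "x \<in> mv_subalgebra M hull {x}" using hull_subset[of "{x}"] by blast
    moreover have "fin (mv_subalgebra M hull {x})" by (rule fin_hull) (use xM in simp_all)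
    ultimately show ?thesis using g_coherent[OF _ N] xM by (simp add: r_def)
  qed
  have cover: "\<exists>N. fin N \<and> x \<in> N \<and> y \<in> N" if "x \<in> mv_carrier M" "y \<in> mv_carrier M" for x y
  proof (intro exI conjI)
    show "fin (mv_subalgebra M hull {x, y})" by (rule fin_hull) (use that in simp_all)
    show "x \<in> mv_subalgebra M hull {x, y}" "y \<in> mv_subalgebra M hull {x, y}"
      using hull_subset[of "{x, y}"] by blast+
  qed
  have zM: "mv_zero M \<in> mv_carrier M" using alg by (simp add: mv_algebra_def Let_def)
  have r: "r \<in> mv_hom M V"
    unfolding mv_hom_def
  proof (intro CollectI conjI ballI)
    have "r x \<in> mv_carrier V" if x: "x \<in> mv_carrier M" for x
    proof -
      obtain N where N: "fin N" "x \<in> N" using cover[OF x x] by blast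
      then show ?thesis using mv_hom_mem[OF g[OF N(1)], of x] r_eq[OF N] by simp
    qed
    then show "r \<in> mv_carrier M \<rightarrow>\<^sub>E mv_carrier V" by (auto simp: PiE_iff r_def)
    obtain N where N: "fin N" "mv_zero M \<in> N" using cover[OF zM zM] by blast
    then show "r (mv_zero M) = mv_zero V" using g[OF N(1)] r_eq[OF N] by (simp add: mv_hom_def)
  next
    fix x assume x: "x \<in> mv_carrier M"
    obtain N where N: "fin N" "x \<in> N" using cover[OF x x] by blast
    then have n: "mv_neg M x \<in> N" by (simp add: fin_def mv_subalgebra_def)
    show "r (mv_neg M x) = mv_neg V (r x)"
      using g[OF N(1)] r_eq[OF N] r_eq[OF N(1) n] N(2) by (simp add: mv_hom_def)
  next
    fix x y assume x: "x \<in> mv_carrier M" and y: "y \<in> mv_carrier M"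
    obtain N where N: "fin N" "x \<in> N" "y \<in> N" using cover[OF x y] by blast
    then have p: "mv_plus M x y \<in> N" by (simp add: fin_def mv_subalgebra_def)
    show "r (mv_plus M x y) = mv_plus V (r x) (r y)"
      using g[OF N(1)] r_eq[OF N(1,2)] r_eq[OF N(1,3)] r_eq[OF N(1) p] N(2,3)
      by (simp add: mv_hom_def)
  qed
  have "m (r x) = x" if x: "x \<in> mv_carrier M" for x
  proof -
    obtain N where N: "fin N" "x \<in> N" using cover[OF x x] by blast
    then show ?thesis using mg r_eq by metis
  qed
  then have "compose (mv_carrier M) m r = restrict id (mv_carrier M)"
    by (auto simp: compose_def intro!: restrict_ext)
  \<comment> \<open>Applying \<open>F\<close> to the splitting of \<open>m\<close> writes
    \<open>u\<close> as a value of \<open>\<theta>\<close>, and all values of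
    \<open>\<theta>\<close> lie in \<open>U\<close>.\<close>
  then have "u = \<theta> s (amap F M V r s u)"
    using amap_comp[OF M V M r m s u] amap_id[OF M s u] Fm[OF s amap_mem[OF M V r s u]] by metis
  then have "u \<in> U s" using \<theta>_mem[OF s amap_mem[OF M V r s u]] by metis
  then show ?thesis by (auto simp: U_def R_def inc_def fin_def)
qed

text \<open>The universal element \<open>u\<close> comes from some \<open>v\<close> over a finite
  subalgebra \<open>N\<close>, and \<open>v\<close> corresponds to a homomorphism \<open>f\<close>
  from \<open>P\<close> to \<open>N\<close>. Followed by the inclusion, \<open>f\<close> fixes
  \<open>u\<close>, so by universality it is the identity of \<open>P\<close>, whose carrier
  therefore lies in \<open>N\<close>.\<close>

lemma finite_representing:
  assumes s: "s \<in> S" and rep: "represents s P u"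
  shows "finite (mv_carrier P)"
proof -
  note P = representsD(1)[OF rep] and u = representsD(2)[OF rep]
  obtain N v where N: "mv_subalgebra P N" "finite N" and v: "v \<in> carrier (omap F (sub P N)) s"
    and incv: "amap F (sub P N) P (restrict id N) s v = u"
    using finite_support[OF P s u] by blast
  note lfN = lf_finite_sub[OF P N] and inc = mv_hom_inclusion[OF N(1)]
  obtain f where f: "f \<in> mv_hom P (sub P N)" and fu: "amap F P (sub P N) f s u = v"
    using representsD(3)[OF rep lfN v] by blast
  have id: "restrict id (mv_carrier P) \<in> mv_hom P P"
    using is_categoryD(1)[OF is_category_lf_mv[of small], of P] P
    by (simp add: lf_mv_category_def lf_def)
  have id_eq: "compose (mv_carrier P) (restrict id N) f = restrict id (mv_carrier P)"
    by (rule representsD(4)[OF rep P mv_hom_compose[OF P lfN P f inc] id])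
      (simp add: amap_comp[OF P lfN P f inc s u] amap_id[OF P s u] fu incv)
  have "x \<in> N" if "x \<in> mv_carrier P" for x
    using fun_cong[OF id_eq, of x] that mv_hom_mem[OF f that] by (simp add: compose_eq)
  then show ?thesis using N(2) by (meson finite_subset subsetI)
qed

section \<open>Contradiction from a finite set of sorts\<close>

lemma sorts_infinite: "infinite S"
proof
  assume "finite S"
  have "\<forall>s\<in>S. \<exists>P u. represents s P u" using representable by blast
  then obtain P u where rep: "\<And>s. s \<in> S \<Longrightarrow> represents s (P s) (u s)" by metis
  note P = representsD(1)[OF rep] and u = representsD(2)[OF rep]
    and ex = representsD(3)[OF rep] and uniq = representsD(4)[OF rep]
    and finP = finite_representing[OF _ rep]
  \<comment> \<open>Inserting 2 makes the maximum meaningful even for empty \<open>S\<close> and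
    puts the index 1 strictly between 0 and \<open>p\<close>.\<close>
  obtain p where p: "prime p" and p_gt: "p > Max (insert 2 ((\<lambda>s. card (mv_carrier (P s))) ` S))"
    using bigger_prime by blast
  have p2: "p > 2" and p_card: "\<And>s. s \<in> S \<Longrightarrow> card (mv_carrier (P s)) < p"
    using p_gt \<open>finite S\<close> by (simp_all add: Max_less_iff)
  \<comment> \<open>Coding the indices inside a small infinite set makes the chain a small
    MV-algebra.\<close>
  obtain I :: "'v set" where I: "small I" "infinite I" using set_universeD(1)[OF universe] by blast
  obtain e :: "nat \<Rightarrow> 'v" where e: "inj e" "range e \<subseteq> I"
    using infinite_countable_subset[OF I(2)] by blast
  define B where "B = lukasiewicz e p"
  have carrier_B: "mv_carrier B = e ` {..p}" by (simp add: B_def lukasiewicz_def)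
  have alg_B: "mv_algebra B" unfolding B_def by (rule mv_algebra_lukasiewicz[OF e(1)])
  have B: "lf B"
    using finite_locally_finite_mv[OF alg_B] set_universeD(2)[OF universe I(1), of "mv_carrier B"] e(2)
    by (auto simp: lf_def carrier_B)
  define T where "T = {e 0, e p}"
  have T: "mv_subalgebra B T" unfolding B_def T_def by (rule two_element_subalgebra[OF e(1)])
  have lfT: "lf (sub B T)" by (rule lf_finite_sub[OF B T]) (simp add: T_def)
  note inc = mv_hom_inclusion[OF T]
  \<comment> \<open>The image is a subalgebra with fewer than \<open>p\<close> elements, too few for
    the whole chain.\<close>
  have image_T: "f ` mv_carrier (P s) \<subseteq> T" if s: "s \<in> S" and f: "f \<in> mv_hom (P s) B" for s f
  proof -
    have "card (f ` mv_carrier (P s)) < p"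
      using card_image_le[OF finP[OF s s], of f] p_card[OF s] by simp
    moreover have "card (e ` {..p}) = Suc p"
      using e(1) by (simp add: card_image inj_on_subset)
    ultimately have "f ` mv_carrier (P s) \<noteq> e ` {..p}" by auto
    then show ?thesis
      using lukasiewicz_prime_subalgebra[OF e(1) p
          mv_hom_image_subalgebra[OF lf_mv_algebra[OF P[OF s]] f, unfolded B_def]]
      unfolding T_def by blast
  qed
  \<comment> \<open>Arrows are extensional functions without a recorded codomain, so enlarging the
    codomain from \<open>T\<close> to the chain leaves \<open>f\<close> literally unchanged.\<close>
  have inc_comp: "compose (mv_carrier (P s)) (restrict id T) f = f"
    if s: "s \<in> S" and f: "f \<in> mv_hom (P s) (sub B T)" for s f
    using f compose_units(2)[of f "mv_carrier (P s)" T] by (simp add: mv_hom_def)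
  \<comment> \<open>Elements of sort \<open>s\<close> on either side correspond to arrows from
    \<open>P s\<close>, and by \<open>image_T\<close> the arrows into \<open>B\<close> are exactly
    those into \<open>T\<close>.\<close>
  have "bij_betw (amap F (sub B T) B (restrict id T) s)
      (carrier (omap F (sub B T)) s) (carrier (omap F B) s)" if s: "s \<in> S" for s
  proof (intro bij_betw_imageI inj_onI subset_antisym image_subsetI subsetI)
    fix x y
    assume x: "x \<in> carrier (omap F (sub B T)) s" and y: "y \<in> carrier (omap F (sub B T)) s"
      and eq: "amap F (sub B T) B (restrict id T) s x = amap F (sub B T) B (restrict id T) s y"
    obtain f where f: "f \<in> mv_hom (P s) (sub B T)" "amap F (P s) (sub B T) f s (u s) = x"
      using ex[OF s lfT x] by blast
    obtain g where g: "g \<in> mv_hom (P s) (sub B T)" "amap F (P s) (sub B T) g s (u s) = y"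
      using ex[OF s lfT y] by blast
    have homs: "f \<in> mv_hom (P s) B" "g \<in> mv_hom (P s) B"
      using mv_hom_compose[OF P[OF s] lfT B f(1) inc] mv_hom_compose[OF P[OF s] lfT B g(1) inc]
        inc_comp[OF s f(1)] inc_comp[OF s g(1)] by simp_all
    have "f = g"
      by (rule uniq[OF s B homs])
        (use amap_comp[OF P[OF s] lfT B f(1) inc s u[OF s]]
          amap_comp[OF P[OF s] lfT B g(1) inc s u[OF s]]
          inc_comp[OF s f(1)] inc_comp[OF s g(1)] f(2) g(2) eq in simp)
    then show "x = y" using f(2) g(2) by simp
  next
    fix x assume "x \<in> carrier (omap F (sub B T)) s"
    then show "amap F (sub B T) B (restrict id T) s x \<in> carrier (omap F B) s"
      by (rule amap_mem[OF lfT B inc s])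
  next
    fix y assume y: "y \<in> carrier (omap F B) s"
    obtain f where f: "f \<in> mv_hom (P s) B" "amap F (P s) B f s (u s) = y"
      using ex[OF s B y] by blast
    have fT: "f \<in> mv_hom (P s) (sub B T)" by (rule mv_hom_corestrict[OF f(1) image_T[OF s f(1)]])
    show "y \<in> amap F (sub B T) B (restrict id T) s ` carrier (omap F (sub B T)) s"
      by (rule image_eqI[OF _ amap_mem[OF P[OF s] lfT fT s u[OF s]]])
        (use amap_comp[OF P[OF s] lfT B fT inc s u[OF s]] inc_comp[OF s fT] f(2) in simp)
  qed
  then have "restrict id T ` mv_carrier (sub B T) = mv_carrier B"
    by (rule bijective_amap_surjective[OF lfT B inc])
  then have "T = e ` {..p}" by (simp add: carrier_B)
  moreover have "e 1 \<notin> T" using p2 e(1) by (auto simp: T_def inj_eq)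
  moreover have "e 1 \<in> e ` {..p}" using p2 by simp
  ultimately show False by simp
qed

end

theorem theorem3p16:
  fixes small :: "'v set \<Rightarrow> bool"
    and S :: "'s set"
    and \<Sigma> :: "('o, 's) signature"
    and K :: "('o, 's, 'v) algebra set"
  assumes "set_universe small"
    and "finite S"
    and "finitary_quasi_variety small S \<Sigma> K"
  shows "\<not> equivalent_categories (lf_mv_category small) (algebra_category S \<Sigma> K)"
proof
  assume "equivalent_categories (lf_mv_category small) (algebra_category S \<Sigma> K)"
  then obtain F where "is_functor (lf_mv_category small) (algebra_category S \<Sigma> K) F"
    "full_faithful (lf_mv_category small) (algebra_category S \<Sigma> K) F"
    "essentially_surjective (lf_mv_category small) (algebra_category S \<Sigma> K) F"
    by (rule equivalence_full_faithful[OF is_category_lf_mv is_category_algebra_category[OF assms(3)]])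
  then interpret lf_mv_quasi_variety small S \<Sigma> K F
    using assms by unfold_locales
  show False using sorts_infinite assms(2) by blast
qed

end
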